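(* The double category $\mathbb D\mathbf{TDX}$ has binary double coproducts of loose arrows. Precisely, let $(\mathcal P,s):\mathcal A\rightsquigarrow\mathcal B$ and $(\mathcal Q,t):\mathcal C\rightsquigarrow\mathcal D$ be 2-transducers. Define $(\mathcal P+\mathcal Q,\ s\oplus t):\mathcal A+\mathcal C\rightsquigarrow\mathcal B+\mathcal D$ by $$(s\oplus t)(a;p,p')=\mathrm{Lan}_{i_{\mathcal B}^*}\,s(a;p,p'),\qquad (s\oplus t)(c;q,q')=\mathrm{Lan}_{i_{\mathcal D}^*}\,t(c;q,q')$$ for $a\in\mathcal A$, $p,p'\in\mathcal P$, $c\in\mathcal C$, $q,q'\in\mathcal Q$, and the empty presheaf on every other summand of $(\mathcal A+\mathcal C)\times(\mathcal P+\mathcal Q)^{op}\times(\mathcal P+\mathcal Q)$. Then there are cells $s\to s\oplus t$ and $t\to s\oplus t$, over the coproduct inclusions $\mathcal A\to\mathcal A+\mathcal C\leftarrow\mathcal C$ and $\mathcal B\to\mathcal B+\mathcal D\leftarrow\mathcal D$, such that every pair of cells $s\to r$, $t\to r$ into a 2-transducer $r:\mathcal X\rightsquigarrow\mathcal Y$ factors through them by a unique cell $s\oplus t\to r$.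
   Context: All categories are small. $\mathcal B^*$ is the free monoidal category on $\mathcal B$: objects are finite lists of objects, morphisms between lists of the same length are tuples of morphisms of $\mathcal B$, none between lists of different lengths; a functor $G:\mathcal B\to\mathcal B'$ induces $G^*:\mathcal B^*\to(\mathcal B')^*$. $i_{\mathcal B}:\mathcal B\to\mathcal B+\mathcal D$, $i_{\mathcal D}:\mathcal D\to\mathcal B+\mathcal D$ are the coproduct inclusions, and $\mathrm{Lan}_{i_{\mathcal B}^*}:[(\mathcal B^* )^{op},\mathrm{Set}]\to[((\mathcal B+\mathcal D)^* )^{op},\mathrm{Set}]$ denotes left Kan extension of presheaves along $(i_{\mathcal B}^* )^{op}$. A 2-transducer (loose arrow of $\mathbb D\mathbf{TDX}$) $(\mathcal Q,t):\mathcal A\rightsquigarrow\mathcal B$ is a category $\mathcal Q$ with a functor $t:\mathcal A\times\mathcal Q^{op}\times\mathcal Q\to[(\mathcal B^* )^{op},\mathrm{Set}]$, with values $t(a;q,q')[\underline b]$. Tight arrows are functors. A cell from $(\mathcal Q,s):\mathcal A\rightsquigarrow\mathcal B$ to $(\mathcal P,t):\mathcal A'\rightsquigarrow\mathcal B'$ over tight arrows $F:\mathcal A\to\mathcal A'$, $G:\mathcal B\to\mathcal B'$ is a pair $(U,\alpha)$ with $U:\mathcal Q\to\mathcal P$ a functor and $\alpha:s(a;q,q')[\underline b]\to t(Fa;Uq,Uq')[G^*\underline b]$ natural; cells compose vertically by composing functors and natural transformations. *)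

theory Defs
  imports "HOL-Library.FuncSet"
begin

section \<open>Small categories and functors\<close>

record ('o, 'm) cat =
  Ob  :: "'o set"
  Arr :: "'m set"
  Dom :: "'m \<Rightarrow> 'o"
  Cod :: "'m \<Rightarrow> 'o"
  Idt :: "'o \<Rightarrow> 'm"
  Cmp :: "'m \<Rightarrow> 'm \<Rightarrow> 'm"   \<comment> \<open>\<open>Cmp C g f\<close> is "g after f", meaningful when \<open>Dom C g = Cod C f\<close>\<close>

locale category =
  fixes C :: "('o, 'm) cat"
  assumes Dom_in [simp]: "f \<in> Arr C \<Longrightarrow> Dom C f \<in> Ob C"
    and Cod_in [simp]: "f \<in> Arr C \<Longrightarrow> Cod C f \<in> Ob C"
    and Idt_in [simp]: "x \<in> Ob C \<Longrightarrow> Idt C x \<in> Arr C"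
    and Dom_Idt [simp]: "x \<in> Ob C \<Longrightarrow> Dom C (Idt C x) = x"
    and Cod_Idt [simp]: "x \<in> Ob C \<Longrightarrow> Cod C (Idt C x) = x"
    and Cmp_in [simp]: "\<lbrakk>f \<in> Arr C; g \<in> Arr C; Dom C g = Cod C f\<rbrakk> \<Longrightarrow> Cmp C g f \<in> Arr C"
    and Dom_Cmp [simp]: "\<lbrakk>f \<in> Arr C; g \<in> Arr C; Dom C g = Cod C f\<rbrakk> \<Longrightarrow> Dom C (Cmp C g f) = Dom C f"
    and Cod_Cmp [simp]: "\<lbrakk>f \<in> Arr C; g \<in> Arr C; Dom C g = Cod C f\<rbrakk> \<Longrightarrow> Cod C (Cmp C g f) = Cod C g"
    and Cmp_Idt_right [simp]: "f \<in> Arr C \<Longrightarrow> Cmp C f (Idt C (Dom C f)) = f"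
    and Cmp_Idt_left [simp]: "f \<in> Arr C \<Longrightarrow> Cmp C (Idt C (Cod C f)) f = f"
    and Cmp_assoc: "\<lbrakk>f \<in> Arr C; g \<in> Arr C; h \<in> Arr C; Dom C g = Cod C f; Dom C h = Cod C g\<rbrakk>
        \<Longrightarrow> Cmp C (Cmp C h g) f = Cmp C h (Cmp C g f)"

record ('o, 'm, 'p, 'n) func =
  fob :: "'o \<Rightarrow> 'p"
  far :: "'m \<Rightarrow> 'n"

text \<open>All structure maps are required to be \<^const>\<open>extensional\<close> (\<^const>\<open>undefined\<close> off their
  domain), so that equality of functors, of natural transformations and of cells is HOL equality.\<close>

locale cat_functor = S: category C + T: category D
  for C :: "('o, 'm) cat" and D :: "('p, 'n) cat" +
  fixes F :: "('o, 'm, 'p, 'n) func"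
  assumes fob_PiE: "fob F \<in> Ob C \<rightarrow>\<^sub>E Ob D"
    and far_PiE: "far F \<in> Arr C \<rightarrow>\<^sub>E Arr D"
    and far_Dom: "f \<in> Arr C \<Longrightarrow> Dom D (far F f) = fob F (Dom C f)"
    and far_Cod: "f \<in> Arr C \<Longrightarrow> Cod D (far F f) = fob F (Cod C f)"
    and far_Idt: "x \<in> Ob C \<Longrightarrow> far F (Idt C x) = Idt D (fob F x)"
    and far_Cmp: "\<lbrakk>f \<in> Arr C; g \<in> Arr C; Dom C g = Cod C f\<rbrakk>
        \<Longrightarrow> far F (Cmp C g f) = Cmp D (far F g) (far F f)"

definition fun_comp ::
  "('o, 'm) cat \<Rightarrow> ('p, 'n, 'q, 'k) func \<Rightarrow> ('o, 'm, 'p, 'n) func \<Rightarrow> ('o, 'm, 'q, 'k) func"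
  where "fun_comp C G F =
    \<lparr>fob = compose (Ob C) (fob G) (fob F), far = compose (Arr C) (far G) (far F)\<rparr>"

definition op_cat :: "('o, 'm) cat \<Rightarrow> ('o, 'm) cat"
  where "op_cat C =
    \<lparr>Ob = Ob C, Arr = Arr C, Dom = Cod C, Cod = Dom C, Idt = Idt C, Cmp = (\<lambda>g f. Cmp C f g)\<rparr>"

definition prod_cat :: "('o, 'm) cat \<Rightarrow> ('p, 'n) cat \<Rightarrow> ('o \<times> 'p, 'm \<times> 'n) cat"
  where "prod_cat C D =
    \<lparr>Ob = Ob C \<times> Ob D, Arr = Arr C \<times> Arr D,
     Dom = map_prod (Dom C) (Dom D), Cod = map_prod (Cod C) (Cod D),
     Idt = map_prod (Idt C) (Idt D),
     Cmp = (\<lambda>g f. (Cmp C (fst g) (fst f), Cmp D (snd g) (snd f)))\<rparr>"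

definition sum_cat :: "('o, 'm) cat \<Rightarrow> ('p, 'n) cat \<Rightarrow> ('o + 'p, 'm + 'n) cat"
  where "sum_cat C D =
    \<lparr>Ob = Ob C <+> Ob D, Arr = Arr C <+> Arr D,
     Dom = map_sum (Dom C) (Dom D), Cod = map_sum (Cod C) (Cod D),
     Idt = map_sum (Idt C) (Idt D),
     Cmp = (\<lambda>g f. case (g, f) of
               (Inl g', Inl f') \<Rightarrow> Inl (Cmp C g' f')
             | (Inr g', Inr f') \<Rightarrow> Inr (Cmp D g' f')
             | _ \<Rightarrow> undefined)\<rparr>"

definition inl_fun :: "('o, 'm) cat \<Rightarrow> ('o, 'm, 'o + 'p, 'm + 'n) func"
  where "inl_fun C = \<lparr>fob = restrict Inl (Ob C), far = restrict Inl (Arr C)\<rparr>"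

definition inr_fun :: "('p, 'n) cat \<Rightarrow> ('p, 'n, 'o + 'p, 'm + 'n) func"
  where "inr_fun D = \<lparr>fob = restrict Inr (Ob D), far = restrict Inr (Arr D)\<rparr>"


section \<open>The free monoidal category\<close>

text \<open>Only the underlying category is needed. Domains and codomains of a tuple of arrows are taken
  entrywise, so there are no arrows between lists of different lengths.\<close>

definition star_cat :: "('o, 'm) cat \<Rightarrow> ('o list, 'm list) cat"
  where "star_cat B =
    \<lparr>Ob = lists (Ob B), Arr = lists (Arr B), Dom = map (Dom B), Cod = map (Cod B),
     Idt = map (Idt B), Cmp = map2 (Cmp B)\<rparr>"

definition star_fun ::
  "('o, 'm) cat \<Rightarrow> ('o, 'm, 'p, 'n) func \<Rightarrow> ('o list, 'm list, 'p list, 'n list) func"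
  where "star_fun B G =
    \<lparr>fob = restrict (map (fob G)) (Ob (star_cat B)),
     far = restrict (map (far G)) (Arr (star_cat B))\<rparr>"


section \<open>Sets, functor categories, presheaves\<close>

text \<open>Arrows of \<open>set_cat\<close> and of \<open>fun_cat\<close> are triples (domain, data, codomain).\<close>

definition mid :: "'a \<times> 'b \<times> 'c \<Rightarrow> 'b"
  where "mid m = fst (snd m)"

type_synonym 'x set_arr = "'x set \<times> ('x \<Rightarrow> 'x) \<times> 'x set"

definition set_cat :: "('x set, 'x set_arr) cat"
  where "set_cat =
    \<lparr>Ob = UNIV, Arr = {(X, f, Y). f \<in> X \<rightarrow>\<^sub>E Y},
     Dom = (\<lambda>(X, f, Y). X), Cod = (\<lambda>(X, f, Y). Y),
     Idt = (\<lambda>X. (X, \<lambda>x\<in>X. x, X)),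
     Cmp = (\<lambda>(Y', g, Z) (X, f, Y). (X, compose X g f, Z))\<rparr>"

locale nat_trans = F: cat_functor C D F + G: cat_functor C D G
  for C :: "('o, 'm) cat" and D :: "('p, 'n) cat"
    and F G :: "('o, 'm, 'p, 'n) func" +
  fixes \<eta> :: "'o \<Rightarrow> 'n"
  assumes nt_PiE: "\<eta> \<in> Ob C \<rightarrow>\<^sub>E Arr D"
    and nt_Dom: "x \<in> Ob C \<Longrightarrow> Dom D (\<eta> x) = fob F x"
    and nt_Cod: "x \<in> Ob C \<Longrightarrow> Cod D (\<eta> x) = fob G x"
    and nt_natural: "f \<in> Arr C \<Longrightarrow>
          Cmp D (far G f) (\<eta> (Dom C f)) = Cmp D (\<eta> (Cod C f)) (far F f)"

type_synonym ('o, 'm, 'p, 'n) nt_arr =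
  "('o, 'm, 'p, 'n) func \<times> ('o \<Rightarrow> 'n) \<times> ('o, 'm, 'p, 'n) func"

definition fun_cat ::
  "('o, 'm) cat \<Rightarrow> ('p, 'n) cat \<Rightarrow> (('o, 'm, 'p, 'n) func, ('o, 'm, 'p, 'n) nt_arr) cat"
  where "fun_cat C D =
    \<lparr>Ob = {F. cat_functor C D F}, Arr = {(F, \<eta>, G). nat_trans C D F G \<eta>},
     Dom = (\<lambda>(F, \<eta>, G). F), Cod = (\<lambda>(F, \<eta>, G). G),
     Idt = (\<lambda>F. (F, \<lambda>x\<in>Ob C. Idt D (fob F x), F)),
     Cmp = (\<lambda>(G', \<theta>, H) (F, \<eta>, G). (F, \<lambda>x\<in>Ob C. Cmp D (\<theta> x) (\<eta> x), H))\<rparr>"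

text \<open>Presheaves on \<open>B\<close> whose values are sets of elements of the type \<open>'x\<close>.\<close>

type_synonym ('o, 'm, 'x) presheaf = "('o, 'm, 'x set, 'x set_arr) func"
type_synonym ('o, 'm, 'x) presheaf_arr = "('o, 'm, 'x set, 'x set_arr) nt_arr"

definition psh_cat :: "('o, 'm) cat \<Rightarrow> (('o, 'm, 'x) presheaf, ('o, 'm, 'x) presheaf_arr) cat"
  where "psh_cat B = fun_cat (op_cat B) set_cat"

definition empty_psh :: "('o, 'm) cat \<Rightarrow> ('o, 'm, 'x) presheaf"
  where "empty_psh B =
    \<lparr>fob = (\<lambda>b\<in>Ob B. {}), far = (\<lambda>u\<in>Arr B. ({}, \<lambda>x. undefined, {}))\<rparr>"

text \<open>Renaming of elements along an injection \<open>j\<close>, as a functor between categories of sets, and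
  postcomposition with a functor. They serve only to bring two presheaves with different element
  types into a common element type.\<close>

definition rename_fun :: "('x \<Rightarrow> 'z) \<Rightarrow> ('x set, 'x set_arr, 'z set, 'z set_arr) func"
  where "rename_fun j =
    \<lparr>fob = (\<lambda>X. j ` X),
     far = restrict (\<lambda>(X, f, Y). (j ` X, \<lambda>z\<in>j ` X. j (f (inv j z)), j ` Y)) (Arr set_cat)\<rparr>"

definition postcomp_arr ::
  "('o, 'm) cat \<Rightarrow> ('p, 'n, 'q, 'k) func \<Rightarrow> ('o, 'm, 'p, 'n) nt_arr \<Rightarrow> ('o, 'm, 'q, 'k) nt_arr"
  where "postcomp_arr C J = (\<lambda>(F, \<eta>, G).
    (fun_comp C J F, \<lambda>x\<in>Ob C. far J (\<eta> x), fun_comp C J G))"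


section \<open>Left Kan extension of presheaves\<close>

text \<open>For \<open>K : B \<rightarrow> B'\<close> and a presheaf \<open>X\<close> on \<open>B\<close>, the left Kan extension along \<open>K\<^sup>o\<^sup>p\<close> is
  the pointwise one: its value at \<open>c\<close> is the coend over \<open>b\<close> of \<open>B'(c, K b) \<times> X b\<close>, i.e. the
  set of triples \<open>(b, u : c \<rightarrow> K b, x \<in> X b)\<close> modulo the equivalence relation generated by
  \<open>(b, K v \<circ> u, x) ~ (b0, u, X(v) x)\<close> for \<open>v : b0 \<rightarrow> b\<close>, \<open>u : c \<rightarrow> K b0\<close>, \<open>x \<in> X b\<close>.\<close>

definition lan_gen ::
  "('o, 'm) cat \<Rightarrow> ('p, 'n) cat \<Rightarrow> ('o, 'm, 'p, 'n) func \<Rightarrow> ('o, 'm, 'x) presheaf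
    \<Rightarrow> 'p \<Rightarrow> ('o \<times> 'n \<times> 'x) set"
  where "lan_gen B B' K X c =
    {(b, u, x). b \<in> Ob B \<and> u \<in> Arr B' \<and> Dom B' u = c \<and> Cod B' u = fob K b \<and> x \<in> fob X b}"

definition lan_step ::
  "('o, 'm) cat \<Rightarrow> ('p, 'n) cat \<Rightarrow> ('o, 'm, 'p, 'n) func \<Rightarrow> ('o, 'm, 'x) presheaf
    \<Rightarrow> 'p \<Rightarrow> ('o \<times> 'n \<times> 'x) rel"
  where "lan_step B B' K X c =
    {((Cod B v, Cmp B' (far K v) u, x), (Dom B v, u, mid (far X v) x)) | v u x.
       v \<in> Arr B \<and> u \<in> Arr B' \<and> Dom B' u = c \<and> Cod B' u = fob K (Dom B v) \<and> x \<in> fob X (Cod B v)}"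

definition lan_rel ::
  "('o, 'm) cat \<Rightarrow> ('p, 'n) cat \<Rightarrow> ('o, 'm, 'p, 'n) func \<Rightarrow> ('o, 'm, 'x) presheaf
    \<Rightarrow> 'p \<Rightarrow> ('o \<times> 'n \<times> 'x) rel"
  where "lan_rel B B' K X c = (lan_step B B' K X c \<union> (lan_step B B' K X c)\<inverse>)\<^sup>*"

definition lan_set ::
  "('o, 'm) cat \<Rightarrow> ('p, 'n) cat \<Rightarrow> ('o, 'm, 'p, 'n) func \<Rightarrow> ('o, 'm, 'x) presheaf
    \<Rightarrow> 'p \<Rightarrow> ('o \<times> 'n \<times> 'x) set set"
  where "lan_set B B' K X c = lan_gen B B' K X c // lan_rel B B' K X c"

text \<open>The action of \<open>w\<close> sends the class of \<open>(b, u, x)\<close> to that of \<open>(b, u \<circ> w, x)\<close>; the map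
  induced by \<open>\<eta> : X \<rightarrow> Y\<close> sends the class of \<open>(b, u, x)\<close> to that of \<open>(b, u, \<eta>\<^sub>b x)\<close>. The image of
  a class under either assignment lies in a single class, obtained by saturating.\<close>

definition lan ::
  "('o, 'm) cat \<Rightarrow> ('p, 'n) cat \<Rightarrow> ('o, 'm, 'p, 'n) func \<Rightarrow> ('o, 'm, 'x) presheaf
    \<Rightarrow> ('p, 'n, ('o \<times> 'n \<times> 'x) set) presheaf"
  where "lan B B' K X =
    \<lparr>fob = (\<lambda>c\<in>Ob B'. lan_set B B' K X c),
     far = (\<lambda>w\<in>Arr B'.
       (lan_set B B' K X (Cod B' w),
        \<lambda>E\<in>lan_set B B' K X (Cod B' w).
          lan_rel B B' K X (Dom B' w) `` ((\<lambda>(b, u, x). (b, Cmp B' u w, x)) ` E),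
        lan_set B B' K X (Dom B' w)))\<rparr>"

definition lan_arr ::
  "('o, 'm) cat \<Rightarrow> ('p, 'n) cat \<Rightarrow> ('o, 'm, 'p, 'n) func \<Rightarrow> ('o, 'm, 'x) presheaf_arr
    \<Rightarrow> ('p, 'n, ('o \<times> 'n \<times> 'x) set) presheaf_arr"
  where "lan_arr B B' K = (\<lambda>(X, \<eta>, Y).
    (lan B B' K X,
     \<lambda>c\<in>Ob B'.
       (lan_set B B' K X c,
        \<lambda>E\<in>lan_set B B' K X c.
          lan_rel B B' K Y c `` ((\<lambda>(b, u, x). (b, u, mid (\<eta> b) x)) ` E),
        lan_set B B' K Y c),
     lan B B' K Y))"


section \<open>2-transducers and their cells\<close>

record ('ao, 'am, 'qo, 'qm, 'bo, 'bm, 'x) transducer =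
  St :: "('qo, 'qm) cat"
  Tr :: "('ao \<times> 'qo \<times> 'qo, 'am \<times> 'qm \<times> 'qm,
          ('bo list, 'bm list, 'x) presheaf, ('bo list, 'bm list, 'x) presheaf_arr) func"

definition idx_cat ::
  "('ao, 'am) cat \<Rightarrow> ('qo, 'qm) cat \<Rightarrow> ('ao \<times> 'qo \<times> 'qo, 'am \<times> 'qm \<times> 'qm) cat"
  where "idx_cat A Q = prod_cat A (prod_cat (op_cat Q) Q)"

definition two_transducer ::
  "('ao, 'am) cat \<Rightarrow> ('bo, 'bm) cat \<Rightarrow> ('ao, 'am, 'qo, 'qm, 'bo, 'bm, 'x) transducer \<Rightarrow> bool"
  where "two_transducer A B S \<longleftrightarrow>
    category A \<and> category B \<and> category (St S) \<and>
    cat_functor (idx_cat A (St S)) (psh_cat (star_cat B)) (Tr S)"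

text \<open>For \<open>i = (a, q, q')\<close>: the set \<open>s(a;q,q')[b]\<close>; its contravariant action in \<open>b\<close>; and the
  component at \<open>b\<close> of the action of an arrow of \<open>A \<times> Q\<^sup>o\<^sup>p \<times> Q\<close>.\<close>

definition val ::
  "('ao, 'am, 'qo, 'qm, 'bo, 'bm, 'x) transducer \<Rightarrow> 'ao \<times> 'qo \<times> 'qo \<Rightarrow> 'bo list \<Rightarrow> 'x set"
  where "val S i b = fob (fob (Tr S) i) b"

definition act_out ::
  "('ao, 'am, 'qo, 'qm, 'bo, 'bm, 'x) transducer \<Rightarrow> 'ao \<times> 'qo \<times> 'qo \<Rightarrow> 'bm list \<Rightarrow> 'x \<Rightarrow> 'x"
  where "act_out S i u = mid (far (fob (Tr S) i) u)"

definition act_in ::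
  "('ao, 'am, 'qo, 'qm, 'bo, 'bm, 'x) transducer \<Rightarrow> 'am \<times> 'qm \<times> 'qm \<Rightarrow> 'bo list \<Rightarrow> 'x \<Rightarrow> 'x"
  where "act_in S f b = mid (mid (far (Tr S) f) b)"

text \<open>A cell together with the tight arrows it lies over. Source and target may have different
  element types \<open>'x\<close>, \<open>'y\<close>, so the components are functions rather than arrows of \<open>set_cat\<close>.\<close>

record ('ao, 'am, 'bo, 'bm, 'qo, 'qm, 'x, 'co, 'cm, 'eo, 'em, 'po, 'pm, 'y) cell =
  tight_src :: "('ao, 'am, 'co, 'cm) func"
  tight_tgt :: "('bo, 'bm, 'eo, 'em) func"
  state_fun :: "('qo, 'qm, 'po, 'pm) func"
  component :: "'ao \<times> 'qo \<times> 'qo \<Rightarrow> 'bo list \<Rightarrow> 'x \<Rightarrow> 'y"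

definition idx_ob ::
  "('ao, 'am, 'bo, 'bm, 'qo, 'qm, 'x, 'co, 'cm, 'eo, 'em, 'po, 'pm, 'y) cell
    \<Rightarrow> 'ao \<times> 'qo \<times> 'qo \<Rightarrow> 'co \<times> 'po \<times> 'po"
  where "idx_ob \<sigma> = map_prod (fob (tight_src \<sigma>)) (map_prod (fob (state_fun \<sigma>)) (fob (state_fun \<sigma>)))"

definition idx_ar ::
  "('ao, 'am, 'bo, 'bm, 'qo, 'qm, 'x, 'co, 'cm, 'eo, 'em, 'po, 'pm, 'y) cell
    \<Rightarrow> 'am \<times> 'qm \<times> 'qm \<Rightarrow> 'cm \<times> 'pm \<times> 'pm"
  where "idx_ar \<sigma> = map_prod (far (tight_src \<sigma>)) (map_prod (far (state_fun \<sigma>)) (far (state_fun \<sigma>)))"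

definition is_cell ::
  "('ao, 'am) cat \<Rightarrow> ('bo, 'bm) cat \<Rightarrow> ('ao, 'am, 'qo, 'qm, 'bo, 'bm, 'x) transducer
    \<Rightarrow> ('co, 'cm) cat \<Rightarrow> ('eo, 'em) cat \<Rightarrow> ('co, 'cm, 'po, 'pm, 'eo, 'em, 'y) transducer
    \<Rightarrow> ('ao, 'am, 'bo, 'bm, 'qo, 'qm, 'x, 'co, 'cm, 'eo, 'em, 'po, 'pm, 'y) cell \<Rightarrow> bool"
  where "is_cell A B S A' B' T \<sigma> \<longleftrightarrow>
    cat_functor A A' (tight_src \<sigma>) \<and>
    cat_functor B B' (tight_tgt \<sigma>) \<and>
    cat_functor (St S) (St T) (state_fun \<sigma>) \<and>
    component \<sigma> \<in> (\<Pi>\<^sub>E i\<in>Ob (idx_cat A (St S)). \<Pi>\<^sub>E b\<in>Ob (star_cat B).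
        val S i b \<rightarrow>\<^sub>E val T (idx_ob \<sigma> i) (fob (star_fun B (tight_tgt \<sigma>)) b)) \<and>
    (\<forall>i\<in>Ob (idx_cat A (St S)). \<forall>u\<in>Arr (star_cat B). \<forall>x\<in>val S i (Cod (star_cat B) u).
        component \<sigma> i (Dom (star_cat B) u) (act_out S i u x) =
        act_out T (idx_ob \<sigma> i) (far (star_fun B (tight_tgt \<sigma>)) u)
          (component \<sigma> i (Cod (star_cat B) u) x)) \<and>
    (\<forall>f\<in>Arr (idx_cat A (St S)). \<forall>b\<in>Ob (star_cat B). \<forall>x\<in>val S (Dom (idx_cat A (St S)) f) b.
        component \<sigma> (Cod (idx_cat A (St S)) f) b (act_in S f b x) =
        act_in T (idx_ar \<sigma> f) (fob (star_fun B (tight_tgt \<sigma>)) b)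
          (component \<sigma> (Dom (idx_cat A (St S)) f) b x))"

text \<open>Vertical composite of \<open>\<sigma>\<close>, a cell out of \<open>S : A \<leadsto> B\<close>, with \<open>\<tau>\<close>.\<close>

definition vcomp ::
  "('ao, 'am) cat \<Rightarrow> ('bo, 'bm) cat \<Rightarrow> ('ao, 'am, 'qo, 'qm, 'bo, 'bm, 'x) transducer
    \<Rightarrow> ('co, 'cm, 'eo, 'em, 'po, 'pm, 'y, 'go, 'gm, 'ho, 'hm, 'ro, 'rm, 'z) cell
    \<Rightarrow> ('ao, 'am, 'bo, 'bm, 'qo, 'qm, 'x, 'co, 'cm, 'eo, 'em, 'po, 'pm, 'y) cell
    \<Rightarrow> ('ao, 'am, 'bo, 'bm, 'qo, 'qm, 'x, 'go, 'gm, 'ho, 'hm, 'ro, 'rm, 'z) cell"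
  where "vcomp A B S \<tau> \<sigma> =
    \<lparr>tight_src = fun_comp A (tight_src \<tau>) (tight_src \<sigma>),
     tight_tgt = fun_comp B (tight_tgt \<tau>) (tight_tgt \<sigma>),
     state_fun = fun_comp (St S) (state_fun \<tau>) (state_fun \<sigma>),
     component = (\<lambda>i\<in>Ob (idx_cat A (St S)). \<lambda>b\<in>Ob (star_cat B).
       compose (val S i b)
         (component \<tau> (idx_ob \<sigma> i) (fob (star_fun B (tight_tgt \<sigma>)) b))
         (component \<sigma> i b))\<rparr>"


section \<open>The coproduct 2-transducer and its coprojections\<close>

text \<open>Extension along the two coproduct inclusions yields different element types, here brought
  together by renaming along \<^const>\<open>Inl\<close> and \<^const>\<open>Inr\<close>.\<close>

type_synonym ('ao, 'am, 'po, 'pm, 'bo, 'bm, 'x, 'co, 'cm, 'qo, 'qm, 'eo, 'em, 'y) sum_transducer =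
  "('ao + 'co, 'am + 'cm, 'po + 'qo, 'pm + 'qm, 'bo + 'eo, 'bm + 'em,
    ('bo list \<times> ('bm + 'em) list \<times> 'x) set + ('eo list \<times> ('bm + 'em) list \<times> 'y) set) transducer"

definition oplus ::
  "('ao, 'am) cat \<Rightarrow> ('bo, 'bm) cat \<Rightarrow> ('ao, 'am, 'po, 'pm, 'bo, 'bm, 'x) transducer
    \<Rightarrow> ('co, 'cm) cat \<Rightarrow> ('eo, 'em) cat \<Rightarrow> ('co, 'cm, 'qo, 'qm, 'eo, 'em, 'y) transducer
    \<Rightarrow> ('ao, 'am, 'po, 'pm, 'bo, 'bm, 'x, 'co, 'cm, 'qo, 'qm, 'eo, 'em, 'y) sum_transducer"
  where "oplus A B S C D T =
    (let BD = star_cat (sum_cat B D);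
         I = idx_cat (sum_cat A C) (sum_cat (St S) (St T));
         lanB = lan (star_cat B) BD (star_fun B (inl_fun B));
         lanD = lan (star_cat D) BD (star_fun D (inr_fun D));
         lanB_arr = lan_arr (star_cat B) BD (star_fun B (inl_fun B));
         lanD_arr = lan_arr (star_cat D) BD (star_fun D (inr_fun D));
         E = empty_psh BD
     in \<lparr>St = sum_cat (St S) (St T),
         Tr = \<lparr>
           fob = (\<lambda>i\<in>Ob I. case i of
               (Inl a, Inl p, Inl p') \<Rightarrow> fun_comp (op_cat BD) (rename_fun Inl) (lanB (fob (Tr S) (a, p, p')))
             | (Inr c, Inr q, Inr q') \<Rightarrow> fun_comp (op_cat BD) (rename_fun Inr) (lanD (fob (Tr T) (c, q, q')))
             | _ \<Rightarrow> E),
           far = (\<lambda>f\<in>Arr I. case f of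
               (Inl f0, Inl g, Inl h) \<Rightarrow> postcomp_arr (op_cat BD) (rename_fun Inl) (lanB_arr (far (Tr S) (f0, g, h)))
             | (Inr f0, Inr g, Inr h) \<Rightarrow> postcomp_arr (op_cat BD) (rename_fun Inr) (lanD_arr (far (Tr T) (f0, g, h)))
             | _ \<Rightarrow> Idt (psh_cat BD) E)\<rparr>\<rparr>)"

text \<open>The components of the coprojections are the units \<open>x \<mapsto> [(b, id, x)]\<close> of the two Kan
  extensions.\<close>

definition coproj_left ::
  "('ao, 'am) cat \<Rightarrow> ('bo, 'bm) cat \<Rightarrow> ('ao, 'am, 'po, 'pm, 'bo, 'bm, 'x) transducer
    \<Rightarrow> ('co, 'cm) cat \<Rightarrow> ('eo, 'em) cat \<Rightarrow> ('co, 'cm, 'qo, 'qm, 'eo, 'em, 'y) transducer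
    \<Rightarrow> ('ao, 'am, 'bo, 'bm, 'po, 'pm, 'x, 'ao + 'co, 'am + 'cm, 'bo + 'eo, 'bm + 'em, 'po + 'qo, 'pm + 'qm,
        ('bo list \<times> ('bm + 'em) list \<times> 'x) set + ('eo list \<times> ('bm + 'em) list \<times> 'y) set) cell"
  where "coproj_left A B S C D T =
    (let BD = star_cat (sum_cat B D); K = star_fun B (inl_fun B)
     in \<lparr>tight_src = inl_fun A, tight_tgt = inl_fun B, state_fun = inl_fun (St S),
         component = (\<lambda>i\<in>Ob (idx_cat A (St S)). \<lambda>b\<in>Ob (star_cat B). \<lambda>x\<in>val S i b.
           Inl (lan_rel (star_cat B) BD K (fob (Tr S) i) (fob K b) `` {(b, Idt BD (fob K b), x)}))\<rparr>)"

definition coproj_right ::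
  "('ao, 'am) cat \<Rightarrow> ('bo, 'bm) cat \<Rightarrow> ('ao, 'am, 'po, 'pm, 'bo, 'bm, 'x) transducer
    \<Rightarrow> ('co, 'cm) cat \<Rightarrow> ('eo, 'em) cat \<Rightarrow> ('co, 'cm, 'qo, 'qm, 'eo, 'em, 'y) transducer
    \<Rightarrow> ('co, 'cm, 'eo, 'em, 'qo, 'qm, 'y, 'ao + 'co, 'am + 'cm, 'bo + 'eo, 'bm + 'em, 'po + 'qo, 'pm + 'qm,
        ('bo list \<times> ('bm + 'em) list \<times> 'x) set + ('eo list \<times> ('bm + 'em) list \<times> 'y) set) cell"
  where "coproj_right A B S C D T =
    (let BD = star_cat (sum_cat B D); K = star_fun D (inr_fun D)
     in \<lparr>tight_src = inr_fun C, tight_tgt = inr_fun D, state_fun = inr_fun (St T),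
         component = (\<lambda>i\<in>Ob (idx_cat C (St T)). \<lambda>d\<in>Ob (star_cat D). \<lambda>y\<in>val T i d.
           Inr (lan_rel (star_cat D) BD K (fob (Tr T) i) (fob K d) `` {(d, Idt BD (fob K d), y)}))\<rparr>)"

end

theory Submission
  imports Defs
begin

text \<open>A cell \<open>s \<oplus> t \<rightarrow> r\<close> has its tight arrows and state functor determined by their restrictions to
  the two summands, and its components vanish on the mixed summands because the presheaves there are
  empty. On the summand of \<open>s\<close>, every element of the Kan extension is \<open>[(b, u, x)] = u\<^sup>* \<eta>(x)\<close>, the
  restriction along \<open>u\<close> of the image of \<open>x\<close> under the unit, so naturality forces its image to be
  \<open>(G\<^sup>* u)\<^sup>* \<sigma>(x)\<close>; this formula respects the coend relation because \<open>\<sigma>\<close> is natural.\<close>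

section \<open>Categories and functors\<close>

text \<open>It is never decided when two triples of the coend are equivalent. Since the relation is
  generated by single steps, a map between two extensions is computed on representatives once it
  sends steps to steps (\<open>saturated_image_class\<close>), and a map out of an extension is well
  defined once it agrees on both ends of each step (\<open>eq_closure_invariant\<close>). Every law
  of the extension then becomes an identity between triples. The summands of \<open>S\<close> and
  \<open>T\<close> are mirror images whose elements have different types. Each argument about one
  summand is therefore made for an abstract 2-transducer \<open>W\<close> that is known only on the
  image of a transducer \<open>S\<close>, where it is the Kan extension renamed along an injection
  \<open>j\<close>; the two instances have \<open>j\<close> equal to \<open>Inl\<close> and
  \<open>Inr\<close>. What remains is to see that no arrow of the index category crosses between
  summands, so that the two instances and the empty presheaves can be glued.\<close>

lemma mid_simp [simp]: "mid (a, b, c) = b"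
  by (simp add: mid_def)

lemma op_cat_simps [simp]:
  "Ob (op_cat C) = Ob C" "Arr (op_cat C) = Arr C" "Dom (op_cat C) = Cod C" "Cod (op_cat C) = Dom C"
  "Idt (op_cat C) = Idt C" "Cmp (op_cat C) g f = Cmp C f g"
  by (simp_all add: op_cat_def)

lemma sum_cat_simps [simp]:
  "Inl x \<in> Ob (sum_cat C D) \<longleftrightarrow> x \<in> Ob C" "Inr y \<in> Ob (sum_cat C D) \<longleftrightarrow> y \<in> Ob D"
  "Inl f \<in> Arr (sum_cat C D) \<longleftrightarrow> f \<in> Arr C" "Inr g \<in> Arr (sum_cat C D) \<longleftrightarrow> g \<in> Arr D"
  "Dom (sum_cat C D) (Inl f) = Inl (Dom C f)" "Dom (sum_cat C D) (Inr g) = Inr (Dom D g)"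
  "Cod (sum_cat C D) (Inl f) = Inl (Cod C f)" "Cod (sum_cat C D) (Inr g) = Inr (Cod D g)"
  "Idt (sum_cat C D) (Inl x) = Inl (Idt C x)" "Idt (sum_cat C D) (Inr y) = Inr (Idt D y)"
  "Cmp (sum_cat C D) (Inl f') (Inl f) = Inl (Cmp C f' f)"
  "Cmp (sum_cat C D) (Inr g') (Inr g) = Inr (Cmp D g' g)"
  by (auto simp: sum_cat_def)

lemma idx_cat_simps [simp]:
  "(a, q, q') \<in> Ob (idx_cat A Q) \<longleftrightarrow> a \<in> Ob A \<and> q \<in> Ob Q \<and> q' \<in> Ob Q"
  "(f, g, h) \<in> Arr (idx_cat A Q) \<longleftrightarrow> f \<in> Arr A \<and> g \<in> Arr Q \<and> h \<in> Arr Q"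
  "Dom (idx_cat A Q) (f, g, h) = (Dom A f, Cod Q g, Dom Q h)"
  "Cod (idx_cat A Q) (f, g, h) = (Cod A f, Dom Q g, Cod Q h)"
  "Idt (idx_cat A Q) (a, q, q') = (Idt A a, Idt Q q, Idt Q q')"
  "Cmp (idx_cat A Q) (f', g', h') (f, g, h) = (Cmp A f' f, Cmp Q g g', Cmp Q h' h)"
  by (auto simp: idx_cat_def prod_cat_def)

lemma star_cat_simps:
  "Ob (star_cat B) = lists (Ob B)" "Arr (star_cat B) = lists (Arr B)"
  "Dom (star_cat B) = map (Dom B)" "Cod (star_cat B) = map (Cod B)"
  "Idt (star_cat B) = map (Idt B)" "Cmp (star_cat B) = map2 (Cmp B)"
  by (simp_all add: star_cat_def)

lemma set_cat_simps [simp]: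
  "Ob set_cat = UNIV" "(X, f, Y) \<in> Arr set_cat \<longleftrightarrow> f \<in> X \<rightarrow>\<^sub>E Y"
  "Dom set_cat (X, f, Y) = X" "Cod set_cat (X, f, Y) = Y"
  "Idt set_cat X = (X, \<lambda>x\<in>X. x, X)"
  "Cmp set_cat (Y', g, Z) (X, f, Y) = (X, compose X g f, Z)"
  by (simp_all add: set_cat_def)

lemma fun_cat_simps [simp]:
  "F \<in> Ob (fun_cat C D) \<longleftrightarrow> cat_functor C D F"
  "(F, \<eta>, G) \<in> Arr (fun_cat C D) \<longleftrightarrow> nat_trans C D F G \<eta>"
  "Dom (fun_cat C D) (F, \<eta>, G) = F" "Cod (fun_cat C D) (F, \<eta>, G) = G"
  "Idt (fun_cat C D) F = (F, \<lambda>x\<in>Ob C. Idt D (fob F x), F)"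
  "Cmp (fun_cat C D) (G', \<theta>, H) (F, \<eta>, G) = (F, \<lambda>x\<in>Ob C. Cmp D (\<theta> x) (\<eta> x), H)"
  by (simp_all add: fun_cat_def)

lemma category_op_cat: "category C \<Longrightarrow> category (op_cat C)"
  unfolding category_def by auto

lemma category_sum_cat:
  assumes "category C" "category D"
  shows "category (sum_cat C D)"
proof -
  interpret C: category C by fact
  interpret D: category D by fact
  \<comment> \<open>Once quantifiers over the sum are split, all arguments carry a constructor;
    composability rules out the pairs with different constructors, on which \<open>Cmp\<close> is
    \<open>undefined\<close>.\<close>
  have *: "(\<forall>z. P z) \<longleftrightarrow> (\<forall>x. P (Inl x)) \<and> (\<forall>y. P (Inr y))" for P :: "'x + 'y \<Rightarrow> bool"
    by (metis sum.exhaust)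
  show ?thesis
    by (unfold_locales; unfold atomize_all atomize_imp; simp add: * C.Cmp_assoc D.Cmp_assoc)
qed

lemma category_idx_cat:
  assumes "category A" "category Q"
  shows "category (idx_cat A Q)"
proof -
  interpret A: category A by fact
  interpret Q: category Q by fact
  show ?thesis
    by (unfold_locales; unfold atomize_all atomize_imp; simp add: split_paired_All A.Cmp_assoc Q.Cmp_assoc)
qed

lemma category_star_cat:
  assumes "category B"
  shows "category (star_cat B)"
proof -
  interpret category B by fact
  \<comment> \<open>\<open>map2\<close> truncates to the shorter list; composable tuples have equal
    length, so no entry is lost.\<close>
  have [dest]: "length g = length f" if "map (Dom B) g = map (Cod B) f" for f g
    using that by (metis length_map)
  show ?thesis
    by unfold_locales
      (auto simp: star_cat_simps list_eq_iff_nth_eq all_set_conv_all_nth in_lists_conv_set Cmp_assoc)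
qed

lemma category_set_cat: "category set_cat"
  by unfold_locales
    (fastforce simp: set_cat_def compose_def PiE_iff extensional_def fun_eq_iff)+

lemma category_fun_cat:
  assumes "category C" "category D"
  shows "category (fun_cat C D)"
proof -
  interpret C: category C by fact
  interpret D: category D by fact
  have id: "nat_trans C D F F (\<lambda>x\<in>Ob C. Idt D (fob F x))" if "cat_functor C D F" for F
  proof -
    interpret F: cat_functor C D F by fact
    show ?thesis
      using F.fob_PiE F.far_PiE
      by unfold_locales (auto simp: PiE_iff extensional_def F.far_Dom F.far_Cod
        simp flip: F.far_Dom F.far_Cod)
  qed
  have cmp: "nat_trans C D F H (\<lambda>x\<in>Ob C. Cmp D (\<theta> x) (\<eta> x))"
    if "nat_trans C D F G \<eta>" "nat_trans C D G H \<theta>" for F G H \<eta> \<theta>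
  proof -
    interpret \<eta>: nat_trans C D F G \<eta> by fact
    interpret \<theta>: nat_trans C D G H \<theta> by fact
    have in_Arr: "\<eta> x \<in> Arr D" "\<theta> x \<in> Arr D" if "x \<in> Ob C" for x
      using that \<eta>.nt_PiE \<theta>.nt_PiE by auto
    have far_in: "far F f \<in> Arr D" "far G f \<in> Arr D" "far H f \<in> Arr D" if "f \<in> Arr C" for f
      using that \<eta>.F.far_PiE \<eta>.G.far_PiE \<theta>.G.far_PiE by auto
    note simps = in_Arr far_in \<eta>.nt_Dom \<eta>.nt_Cod \<theta>.nt_Dom \<theta>.nt_Cod
      \<eta>.F.far_Dom \<eta>.F.far_Cod \<eta>.G.far_Dom \<eta>.G.far_Cod \<theta>.G.far_Dom \<theta>.G.far_Cod
    show ?thesis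
    proof unfold_locales
      fix f assume f: "f \<in> Arr C"
      have "Cmp D (far H f) (Cmp D (\<theta> (Dom C f)) (\<eta> (Dom C f)))
          = Cmp D (Cmp D (\<theta> (Cod C f)) (far G f)) (\<eta> (Dom C f))"
        using f by (simp add: simps D.Cmp_assoc[symmetric] \<theta>.nt_natural)
      also have "\<dots> = Cmp D (Cmp D (\<theta> (Cod C f)) (\<eta> (Cod C f))) (far F f)"
        using f by (simp add: simps D.Cmp_assoc \<eta>.nt_natural)
      finally show "Cmp D (far H f) ((\<lambda>x\<in>Ob C. Cmp D (\<theta> x) (\<eta> x)) (Dom C f)) =
        Cmp D ((\<lambda>x\<in>Ob C. Cmp D (\<theta> x) (\<eta> x)) (Cod C f)) (far F f)"
        using f by simp
    qed (auto simp: simps)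
  qed
  \<comment> \<open>Composites are restrictions to \<open>Ob C\<close>, so the unit laws yield
    agreement on \<open>Ob C\<close> only; extensionality of \<open>\<eta>\<close> makes this an
    equality.\<close>
  have ext: "(\<lambda>x\<in>Ob C. e x) = \<eta>" if "nat_trans C D F G \<eta>" "\<And>x. x \<in> Ob C \<Longrightarrow> e x = \<eta> x" for F G e \<eta>
    using that nat_trans.nt_PiE[OF that(1)] by (auto simp: PiE_def extensional_def fun_eq_iff)
  show ?thesis
  proof (unfold_locales, goal_cases)
    case (9 f)
    then show ?case
      by (cases f) (auto intro!: ext simp: nat_trans.nt_Dom[symmetric] nat_trans.nt_PiE[THEN PiE_mem])
  next
    case (10 f)
    then show ?case
      by (cases f) (auto intro!: ext simp: nat_trans.nt_Cod[symmetric] nat_trans.nt_PiE[THEN PiE_mem])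
  next
    case (11 f g h)
    then show ?case
      by (cases f; cases g; cases h) (auto intro!: restrict_ext D.Cmp_assoc
        simp: nat_trans.nt_Dom nat_trans.nt_Cod nat_trans.nt_PiE[THEN PiE_mem])
  next
    case (1 f)
    then show ?case by (cases f) (auto simp: nat_trans_def)
  next
    case (2 f)
    then show ?case by (cases f) (auto simp: nat_trans_def)
  next
    case (6 f g)
    then show ?case by (cases f; cases g) (auto intro: cmp)
  qed (auto simp: id)
qed

lemma category_psh_cat: "category B \<Longrightarrow> category (psh_cat B)"
  unfolding psh_cat_def by (intro category_fun_cat category_op_cat category_set_cat)

lemma cat_functor_inl_fun:
  assumes "category C" "category D"
  shows "cat_functor C (sum_cat C D) (inl_fun C)"
proof -
  interpret C: category C by fact
  interpret CD: category "sum_cat C D" using assms by (rule category_sum_cat)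
  show ?thesis
    by unfold_locales (auto simp: inl_fun_def)
qed

lemma cat_functor_inr_fun:
  assumes "category C" "category D"
  shows "cat_functor D (sum_cat C D) (inr_fun D)"
proof -
  interpret D: category D by fact
  interpret CD: category "sum_cat C D" using assms by (rule category_sum_cat)
  show ?thesis
    by unfold_locales (auto simp: inr_fun_def)
qed

context cat_functor
begin

lemma fob_in [simp]: "x \<in> Ob C \<Longrightarrow> fob F x \<in> Ob D"
  using fob_PiE by auto

lemma far_in [simp]: "f \<in> Arr C \<Longrightarrow> far F f \<in> Arr D"
  using far_PiE by auto

lemma cat_functor_star_fun: "cat_functor (star_cat C) (star_cat D) (star_fun C F)"
proof -
  interpret SC: category "star_cat C" by (intro category_star_cat S.category_axioms)
  interpret SD: category "star_cat D" by (intro category_star_cat T.category_axioms)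
  show ?thesis
  proof (unfold_locales, goal_cases)
    case (6 f g)
    have "length g = length f"
      using 6 by (metis length_map star_cat_simps(3,4))
    with 6 SC.Cmp_in[of f g] show ?case
      by (auto simp: star_fun_def star_cat_simps in_lists_conv_set list_eq_iff_nth_eq all_set_conv_all_nth far_Cmp)
  qed (auto simp: star_fun_def star_cat_simps in_lists_conv_set far_Dom far_Cod far_Idt)
qed

end

lemma cat_functor_fun_comp:
  assumes "cat_functor C D F" "cat_functor D E G"
  shows "cat_functor C E (fun_comp C G F)"
proof -
  interpret F: cat_functor C D F by fact
  interpret G: cat_functor D E G by fact
  show ?thesis
    by unfold_locales (auto simp: fun_comp_def compose_def F.far_Dom F.far_Cod F.far_Idt F.far_Cmp
      G.far_Dom G.far_Cod G.far_Idt G.far_Cmp)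
qed

text \<open>Injectivity makes \<open>inv j\<close> a retraction of \<open>j\<close>, so conjugation
  by \<open>j\<close> preserves identities and composites.\<close>

lemma cat_functor_rename_fun:
  assumes "inj j"
  shows "cat_functor set_cat set_cat (rename_fun j)"
proof -
  interpret category set_cat by (rule category_set_cat)
  show ?thesis
  proof (unfold_locales, goal_cases)
    case (6 f g)
    with Cmp_in[OF this] assms show ?case
      by (cases f; cases g) (auto simp: rename_fun_def compose_def fun_eq_iff)
  qed (use assms in \<open>auto simp: rename_fun_def fun_eq_iff PiE_iff\<close>)
qed

section \<open>Presheaves\<close>

text \<open>Whiskering: the naturality square is the image under \<open>J\<close> of that of
  \<open>\<eta>\<close>.\<close>

lemma postcomp_arr_nat_trans:
  assumes "nat_trans C D F G \<eta>" "cat_functor D E J"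
  shows "nat_trans C E (fun_comp C J F) (fun_comp C J G) (\<lambda>x\<in>Ob C. far J (\<eta> x))"
proof -
  interpret \<eta>: nat_trans C D F G \<eta> by fact
  interpret J: cat_functor D E J by fact
  interpret JF: cat_functor C E "fun_comp C J F"
    by (rule cat_functor_fun_comp) (fact \<eta>.F.cat_functor_axioms, fact assms)
  interpret JG: cat_functor C E "fun_comp C J G"
    by (rule cat_functor_fun_comp) (fact \<eta>.G.cat_functor_axioms, fact assms)
  have [simp]: "\<eta> x \<in> Arr D" if "x \<in> Ob C" for x
    using that \<eta>.nt_PiE by auto
  show ?thesis
    by unfold_locales (auto simp: fun_comp_def compose_def J.far_Dom J.far_Cod \<eta>.nt_Dom \<eta>.nt_Cod
      \<eta>.nt_natural \<eta>.F.far_Dom \<eta>.F.far_Cod \<eta>.G.far_Dom \<eta>.G.far_Cod simp flip: J.far_Cmp)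
qed

lemma postcomp_arr_in:
  assumes "m \<in> Arr (fun_cat C D)" "cat_functor D E J"
  shows "postcomp_arr C J m \<in> Arr (fun_cat C E)"
    and "Dom (fun_cat C E) (postcomp_arr C J m) = fun_comp C J (Dom (fun_cat C D) m)"
    and "Cod (fun_cat C E) (postcomp_arr C J m) = fun_comp C J (Cod (fun_cat C D) m)"
  using assms by (cases m; simp add: postcomp_arr_def postcomp_arr_nat_trans)+

lemma postcomp_arr_Idt:
  assumes "cat_functor C D F" "cat_functor D E J"
  shows "postcomp_arr C J (Idt (fun_cat C D) F) = Idt (fun_cat C E) (fun_comp C J F)"
proof -
  interpret F: cat_functor C D F by fact
  interpret J: cat_functor D E J by fact
  show ?thesis
    by (simp add: postcomp_arr_def fun_comp_def compose_def J.far_Idt cong: restrict_cong)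
qed

lemma postcomp_arr_Cmp:
  assumes "m \<in> Arr (fun_cat C D)" "n \<in> Arr (fun_cat C D)" "cat_functor D E J"
    and "Dom (fun_cat C D) n = Cod (fun_cat C D) m"
  shows "postcomp_arr C J (Cmp (fun_cat C D) n m) =
    Cmp (fun_cat C E) (postcomp_arr C J n) (postcomp_arr C J m)"
proof -
  interpret J: cat_functor D E J by fact
  show ?thesis
    using assms by (cases m; cases n) (auto simp: postcomp_arr_def nat_trans.nt_PiE[THEN PiE_mem]
      nat_trans.nt_Dom nat_trans.nt_Cod intro!: restrict_ext J.far_Cmp)
qed

abbreviation is_psh :: "('o, 'm) cat \<Rightarrow> ('o, 'm, 'x) presheaf \<Rightarrow> bool"
  where "is_psh B X \<equiv> cat_functor (op_cat B) set_cat X"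

lemma set_cat_arr_eq:
  assumes "m \<in> Arr set_cat"
  shows "m = (Dom set_cat m, mid m, Cod set_cat m)" "mid m \<in> Dom set_cat m \<rightarrow>\<^sub>E Cod set_cat m"
  using assms by (cases m; simp)+

lemma mid_Cmp_set_cat:
  assumes "m \<in> Arr set_cat" "n \<in> Arr set_cat"
  shows "mid (Cmp set_cat n m) = compose (Dom set_cat m) (mid n) (mid m)"
  using assms by (cases m; cases n) simp

text \<open>The functor laws of \<open>X\<close> equate triples in \<open>set_cat\<close>; these
  facts pass to the underlying functions, so that later arguments can work with elements.\<close>

lemma is_psh_facts:
  assumes "is_psh B X"
  shows psh_far_eq: "v \<in> Arr B \<Longrightarrow> far X v = (fob X (Cod B v), mid (far X v), fob X (Dom B v))"
    and psh_act_PiE: "v \<in> Arr B \<Longrightarrow> mid (far X v) \<in> fob X (Cod B v) \<rightarrow>\<^sub>E fob X (Dom B v)"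
    and psh_act_Idt: "b \<in> Ob B \<Longrightarrow> x \<in> fob X b \<Longrightarrow> mid (far X (Idt B b)) x = x"
    and psh_act_Cmp: "\<lbrakk>f \<in> Arr B; g \<in> Arr B; Dom B g = Cod B f; x \<in> fob X (Cod B g)\<rbrakk>
      \<Longrightarrow> mid (far X (Cmp B g f)) x = mid (far X f) (mid (far X g) x)"
proof -
  interpret X: cat_functor "op_cat B" set_cat X by fact
  note X.far_Dom[simp] X.far_Cod[simp] X.far_Cmp[simp] X.far_Idt[simp]
  show "far X v = (fob X (Cod B v), mid (far X v), fob X (Dom B v))" if "v \<in> Arr B"
    using set_cat_arr_eq(1)[OF X.far_in, of v] that by simp
  show "mid (far X v) \<in> fob X (Cod B v) \<rightarrow>\<^sub>E fob X (Dom B v)" if "v \<in> Arr B"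
    using set_cat_arr_eq(2)[OF X.far_in, of v] that by simp
  show "mid (far X (Idt B b)) x = x" if "b \<in> Ob B" "x \<in> fob X b"
    using that X.far_Idt[of b] by simp
  show "mid (far X (Cmp B g f)) x = mid (far X f) (mid (far X g) x)"
    if "f \<in> Arr B" "g \<in> Arr B" "Dom B g = Cod B f" "x \<in> fob X (Cod B g)"
    using that X.far_Cmp[of g f] mid_Cmp_set_cat[OF X.far_in X.far_in, of g f]
    by (simp add: compose_def)
qed

text \<open>The way back from elements to triples: the functions \<open>h v\<close> are extensional
  on the values of \<open>X\<close>, so laws checked on elements already give equality of arrows of
  \<open>set_cat\<close>.\<close>

lemma pshI:
  assumes "category B" "fob X \<in> extensional (Ob B)" "far X \<in> extensional (Arr B)"
    and far: "\<And>v. v \<in> Arr B \<Longrightarrow> far X v = (fob X (Cod B v), h v, fob X (Dom B v))"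
    and h: "\<And>v. v \<in> Arr B \<Longrightarrow> h v \<in> fob X (Cod B v) \<rightarrow>\<^sub>E fob X (Dom B v)"
    and Idt: "\<And>b x. b \<in> Ob B \<Longrightarrow> x \<in> fob X b \<Longrightarrow> h (Idt B b) x = x"
    and Cmp: "\<And>f g x. \<lbrakk>f \<in> Arr B; g \<in> Arr B; Dom B g = Cod B f; x \<in> fob X (Cod B g)\<rbrakk>
      \<Longrightarrow> h (Cmp B g f) x = h f (h g x)"
  shows "is_psh B X"
proof -
  interpret category B by fact
  interpret op: category "op_cat B" by (rule category_op_cat) fact
  interpret set: category set_cat by (rule category_set_cat)
  have "h (Idt B b) = (\<lambda>x\<in>fob X b. x)" if "b \<in> Ob B" for b
    using h[of "Idt B b"] that by (intro extensionalityI[of _ "fob X b"]) (auto simp: PiE_def Idt)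
  moreover have "h (Cmp B g f) = compose (fob X (Cod B g)) (h f) (h g)"
    if "f \<in> Arr B" "g \<in> Arr B" "Dom B g = Cod B f" for f g
    using h[of "Cmp B g f"] that
    by (intro extensionalityI[of _ "fob X (Cod B g)"]) (auto simp: PiE_def Cmp compose_def)
  ultimately show ?thesis
    using assms(2,3) h by unfold_locales (auto simp: far PiE_iff)
qed

lemma psh_nat_facts:
  assumes "nat_trans (op_cat B) set_cat X Y \<eta>"
  shows psh_nat_eq: "b \<in> Ob B \<Longrightarrow> \<eta> b = (fob X b, mid (\<eta> b), fob Y b)"
    and psh_nat_PiE: "b \<in> Ob B \<Longrightarrow> mid (\<eta> b) \<in> fob X b \<rightarrow>\<^sub>E fob Y b"
    and psh_nat_natural: "v \<in> Arr B \<Longrightarrow> x \<in> fob X (Cod B v) \<Longrightarrow>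
      mid (\<eta> (Dom B v)) (mid (far X v) x) = mid (far Y v) (mid (\<eta> (Cod B v)) x)"
proof -
  interpret \<eta>: nat_trans "op_cat B" set_cat X Y \<eta> by fact
  have in_Arr: "b \<in> Ob B \<Longrightarrow> \<eta> b \<in> Arr set_cat" for b
    using \<eta>.nt_PiE by auto
  show "b \<in> Ob B \<Longrightarrow> \<eta> b = (fob X b, mid (\<eta> b), fob Y b)"
    "b \<in> Ob B \<Longrightarrow> mid (\<eta> b) \<in> fob X b \<rightarrow>\<^sub>E fob Y b"
    using set_cat_arr_eq[OF in_Arr, of b] by (simp_all add: \<eta>.nt_Dom \<eta>.nt_Cod)
  show "mid (\<eta> (Dom B v)) (mid (far X v) x) = mid (far Y v) (mid (\<eta> (Cod B v)) x)"
    if "v \<in> Arr B" "x \<in> fob X (Cod B v)"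
  proof -
    have ob: "Cod B v \<in> Ob B" "Dom B v \<in> Ob B"
      using that \<eta>.F.S.Dom_in \<eta>.F.S.Cod_in by auto
    show ?thesis
    using \<eta>.nt_natural[of v] that ob
      mid_Cmp_set_cat[OF in_Arr \<eta>.G.far_in, of "Cod B v" v]
      mid_Cmp_set_cat[OF \<eta>.F.far_in in_Arr, of v "Dom B v"]
    by (simp add: \<eta>.nt_Dom \<eta>.F.far_Dom compose_def fun_eq_iff) metis
  qed
qed

lemma psh_natI:
  assumes X: "is_psh B X" and Y: "is_psh B Y" and "\<eta> \<in> extensional (Ob B)"
    and \<eta>: "\<And>b. b \<in> Ob B \<Longrightarrow> \<eta> b = (fob X b, h b, fob Y b)"
    and h: "\<And>b. b \<in> Ob B \<Longrightarrow> h b \<in> fob X b \<rightarrow>\<^sub>E fob Y b"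
    and natural: "\<And>v x. v \<in> Arr B \<Longrightarrow> x \<in> fob X (Cod B v) \<Longrightarrow>
      h (Dom B v) (mid (far X v) x) = mid (far Y v) (h (Cod B v) x)"
  shows "nat_trans (op_cat B) set_cat X Y \<eta>"
proof -
  interpret X: cat_functor "op_cat B" set_cat X by fact
  interpret Y: cat_functor "op_cat B" set_cat Y by fact
  show ?thesis
  proof unfold_locales
    fix v assume v: "v \<in> Arr (op_cat B)"
    then have ob: "Cod B v \<in> Ob B" "Dom B v \<in> Ob B"
      using X.S.Dom_in X.S.Cod_in by auto
    then show "Cmp set_cat (far Y v) (\<eta> (Dom (op_cat B) v)) = Cmp set_cat (\<eta> (Cod (op_cat B) v)) (far X v)"
      using v natural[of v]
      by (subst psh_far_eq[OF X], simp, subst psh_far_eq[OF Y], simp)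
        (auto simp: \<eta> compose_def fun_eq_iff)
  qed (use assms in \<open>auto simp: PiE_iff\<close>)
qed

lemma fun_comp_rename:
  assumes "is_psh B X"
  shows "b \<in> Ob B \<Longrightarrow> fob (fun_comp (op_cat B) (rename_fun j) X) b = j ` fob X b"
    and "inj j \<Longrightarrow> v \<in> Arr B \<Longrightarrow> x \<in> fob X (Cod B v) \<Longrightarrow>
      mid (far (fun_comp (op_cat B) (rename_fun j) X) v) (j x) = j (mid (far X v) x)"
proof -
  interpret X: cat_functor "op_cat B" set_cat X by fact
  show "b \<in> Ob B \<Longrightarrow> fob (fun_comp (op_cat B) (rename_fun j) X) b = j ` fob X b"
    by (simp add: fun_comp_def rename_fun_def compose_def)
  assume *: "inj j" "v \<in> Arr B" "x \<in> fob X (Cod B v)"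
  then have "(fob X (Cod B v), mid (far X v), fob X (Dom B v)) \<in> Arr set_cat"
    using psh_far_eq[OF assms] X.far_in[of v] by simp
  with * show "mid (far (fun_comp (op_cat B) (rename_fun j) X) v) (j x) = j (mid (far X v) x)"
    by (simp add: fun_comp_def rename_fun_def compose_def) (subst psh_far_eq[OF assms]; simp)
qed

lemma postcomp_rename:
  assumes "nat_trans (op_cat B) set_cat X Y \<eta>" "inj j" "b \<in> Ob B" "x \<in> fob X b"
  shows "mid (mid (postcomp_arr (op_cat B) (rename_fun j) (X, \<eta>, Y)) b) (j x) = j (mid (\<eta> b) x)"
  using assms psh_nat_PiE[OF assms(1,3)]
  by (simp add: postcomp_arr_def rename_fun_def) (subst (1 2) psh_nat_eq[OF assms(1)]; simp)

section \<open>The left Kan extension is functorial\<close>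

text \<open>\<open>lan_rel\<close> is this closure of \<open>lan_step\<close>. The facts below hold
  for any generating relation, which leaves only single steps to be inspected later.\<close>

abbreviation eq_closure :: "'a rel \<Rightarrow> 'a rel"
  where "eq_closure s \<equiv> (s \<union> s\<inverse>)\<^sup>*"

lemma equiv_eq_closure: "equiv UNIV (eq_closure s)"
  by (auto intro!: equivI refl_rtrancl sym_rtrancl trans_rtrancl simp: sym_Un_converse)

lemma eq_closure_map:
  assumes "(e, e') \<in> eq_closure s" "\<And>e e'. (e, e') \<in> s \<Longrightarrow> (f e, f e') \<in> s'"
  shows "(f e, f e') \<in> eq_closure s'"
  using assms(1) by (induction rule: rtrancl_induct) (auto dest!: assms(2) intro: rtrancl_into_rtrancl)

lemma eq_closure_invariant:
  assumes "(e, e') \<in> eq_closure s" "\<And>e e'. (e, e') \<in> s \<Longrightarrow> f e = f e'"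
  shows "f e = f e'"
  using assms(1) by (induction rule: rtrancl_induct) (auto dest!: assms(2))

text \<open>All members of the image are related to \<open>f e\<close>, because \<open>f\<close>
  preserves steps, and \<open>f e\<close> is one of them; saturation thus yields exactly its class.
  Both \<open>lan\<close> and \<open>lan_arr\<close> act by such a saturated image, and this is how
  they are computed on representatives.\<close>

lemma saturated_image_class:
  assumes "\<And>e e'. (e, e') \<in> s \<Longrightarrow> (f e, f e') \<in> s'"
  shows "eq_closure s' `` (f ` (eq_closure s `` {e})) = eq_closure s' `` {f e}"
proof -
  have "(f e, f e') \<in> eq_closure s'" if "(e, e') \<in> eq_closure s" for e'
    using that assms by (rule eq_closure_map)
  then show ?thesis
    by (auto intro: rtrancl_trans)
qed

locale kan = cat_functor B B' K
  for B :: "('o, 'm) cat" and B' :: "('p, 'n) cat" and K :: "('o, 'm, 'p, 'n) func"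
begin

abbreviation "gen \<equiv> lan_gen B B' K"

definition cls :: "('o, 'm, 'x) presheaf \<Rightarrow> 'p \<Rightarrow> 'o \<times> 'n \<times> 'x \<Rightarrow> ('o \<times> 'n \<times> 'x) set"
  where "cls X c e = lan_rel B B' K X c `` {e}"

abbreviation "Lan \<equiv> lan B B' K"
abbreviation "Lan_arr \<equiv> lan_arr B B' K"

lemma in_gen [simp]: "(b, u, x) \<in> gen X c \<longleftrightarrow>
  b \<in> Ob B \<and> u \<in> Arr B' \<and> Dom B' u = c \<and> Cod B' u = fob K b \<and> x \<in> fob X b"
  by (simp add: lan_gen_def)

lemma lan_set_eq: "lan_set B B' K X c = cls X c ` gen X c"
  by (auto simp: lan_set_def quotient_def cls_def)

lemma lan_setE:
  assumes "E \<in> lan_set B B' K X c"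
  obtains b u x where "(b, u, x) \<in> gen X c" "E = cls X c (b, u, x)"
  using assms unfolding lan_set_eq by auto

lemma cls_in [intro]: "(b, u, x) \<in> gen X c \<Longrightarrow> cls X c (b, u, x) \<in> lan_set B B' K X c"
  unfolding lan_set_eq by blast

lemma self_in_cls: "e \<in> cls X c e"
  by (simp add: cls_def lan_rel_def)

text \<open>Naturality of the unit in the list \<open>b\<close> rests on this
  identification.\<close>

lemma cls_step:
  assumes "v \<in> Arr B" "u \<in> Arr B'" "Dom B' u = c" "Cod B' u = fob K (Dom B v)" "x \<in> fob X (Cod B v)"
  shows "cls X c (Cod B v, Cmp B' (far K v) u, x) = cls X c (Dom B v, u, mid (far X v) x)"
proof -
  have "((Cod B v, Cmp B' (far K v) u, x), (Dom B v, u, mid (far X v) x)) \<in> lan_rel B B' K X c"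
    using assms unfolding lan_rel_def lan_step_def by (intro r_into_rtrancl UnI1) auto
  then show ?thesis
    unfolding cls_def lan_rel_def by (rule equiv_class_eq[OF equiv_eq_closure])
qed

lemma lan_act_cls:
  assumes "w \<in> Arr B'" "(b, u, x) \<in> gen X (Cod B' w)"
  shows "mid (far (Lan X) w) (cls X (Cod B' w) (b, u, x)) = cls X (Dom B' w) (b, Cmp B' u w, x)"
proof -
  let ?f = "\<lambda>(b, u, x). (b, Cmp B' u w, x)"
  have step: "(?f e, ?f e') \<in> lan_step B B' K X (Dom B' w)"
    if "(e, e') \<in> lan_step B B' K X (Cod B' w)" for e e'
  proof -
    from that obtain v u x where *: "v \<in> Arr B" "u \<in> Arr B'" "Dom B' u = Cod B' w"
      "Cod B' u = fob K (Dom B v)" "x \<in> fob X (Cod B v)"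
      and e: "e = (Cod B v, Cmp B' (far K v) u, x)" "e' = (Dom B v, u, mid (far X v) x)"
      unfolding lan_step_def by auto
    \<comment> \<open>By associativity, composing with \<open>K v\<close> on one side commutes with
      composing with \<open>w\<close> on the other, so the step of \<open>v\<close>,
      \<open>u\<close>, \<open>x\<close> goes to the step of \<open>v\<close>, \<open>u\<close>
      after \<open>w\<close>, \<open>x\<close>.\<close>
    have "?f e = (Cod B v, Cmp B' (far K v) (Cmp B' u w), x)"
      using * assms(1) by (simp add: e T.Cmp_assoc far_Dom)
    then show ?thesis
      using * assms(1) unfolding lan_step_def e(2)
      by (auto intro!: exI[of _ v] exI[of _ "Cmp B' u w"])
  qed
  have "mid (far (Lan X) w) (cls X (Cod B' w) (b, u, x)) =
      lan_rel B B' K X (Dom B' w) `` (?f ` cls X (Cod B' w) (b, u, x))"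
    using assms by (simp add: lan_def cls_in)
  also have "\<dots> = cls X (Dom B' w) (?f (b, u, x))"
    unfolding cls_def lan_rel_def by (rule saturated_image_class) (rule step)
  finally show ?thesis by simp
qed

lemma lan_arr_cls:
  assumes "nat_trans (op_cat B) set_cat X Y \<eta>" "c \<in> Ob B'" "(b, u, x) \<in> gen X c"
  shows "mid (mid (Lan_arr (X, \<eta>, Y)) c) (cls X c (b, u, x)) = cls Y c (b, u, mid (\<eta> b) x)"
proof -
  let ?f = "\<lambda>(b, u, x). (b, u, mid (\<eta> b) x)"
  have step: "(?f e, ?f e') \<in> lan_step B B' K Y c" if "(e, e') \<in> lan_step B B' K X c" for e e'
  proof -
    from that obtain v u x where *: "v \<in> Arr B" "u \<in> Arr B'" "Dom B' u = c"
      "Cod B' u = fob K (Dom B v)" "x \<in> fob X (Cod B v)"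
      and e: "e = (Cod B v, Cmp B' (far K v) u, x)" "e' = (Dom B v, u, mid (far X v) x)"
      unfolding lan_step_def by auto
    \<comment> \<open>The image is the step of \<open>v\<close>, \<open>u\<close> and this element;
      its second triple has the required form because \<open>\<eta>\<close> is natural at
      \<open>v\<close>.\<close>
    have "mid (\<eta> (Cod B v)) x \<in> fob Y (Cod B v)"
      using psh_nat_PiE[OF assms(1), of "Cod B v"] * by auto
    then show ?thesis
      using * unfolding lan_step_def e
      by (auto simp: psh_nat_natural[OF assms(1)] intro!: exI[of _ v] exI[of _ u])
  qed
  have "mid (mid (Lan_arr (X, \<eta>, Y)) c) (cls X c (b, u, x)) =
      lan_rel B B' K Y c `` (?f ` cls X c (b, u, x))"
    using assms by (simp add: lan_arr_def cls_in)
  also have "\<dots> = cls Y c (?f (b, u, x))"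
    unfolding cls_def lan_rel_def by (rule saturated_image_class) (rule step)
  finally show ?thesis by simp
qed

text \<open>On representatives \<open>w\<close> acts by precomposition, so the functor laws are the
  unit and associativity laws of \<open>B'\<close>.\<close>

lemma is_psh_lan: "is_psh B' (Lan X)"
proof (rule pshI[where h = "\<lambda>w. mid (far (Lan X) w)"], goal_cases)
  case (4 v)
  then show ?case by (simp add: lan_def)
next
  case (5 w)
  have "mid (far (Lan X) w) E \<in> lan_set B B' K X (Dom B' w)" if "E \<in> lan_set B B' K X (Cod B' w)" for E
    using that 5 by (auto elim!: lan_setE simp: lan_act_cls intro!: cls_in)
  with 5 show ?case
    by (auto simp: lan_def)
next
  case (6 c E)
  then have "E \<in> lan_set B B' K X c"
    by (simp add: lan_def)
  with 6 lan_act_cls[of "Idt B' c" _ _ _ X] show ?case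
    by (auto elim!: lan_setE)
next
  case (7 f g E)
  then have "E \<in> lan_set B B' K X (Cod B' g)"
    by (simp add: lan_def)
  with 7 show ?case
    using lan_act_cls[of "Cmp B' g f" _ _ _ X] lan_act_cls[of f _ _ _ X]
    by (auto elim!: lan_setE simp: lan_act_cls T.Cmp_assoc)
qed (auto simp: lan_def T.category_axioms)

lemma fob_lan: "c \<in> Ob B' \<Longrightarrow> fob (Lan X) c = lan_set B B' K X c"
  by (simp add: lan_def)

text \<open>The action of \<open>w\<close> changes only the middle entry of a triple and the map
  induced by \<open>\<eta>\<close> only the last one, so they commute.\<close>

lemma lan_arr_nat_trans:
  assumes "nat_trans (op_cat B) set_cat X Y \<eta>"
  shows "nat_trans (op_cat B') set_cat (Lan X) (Lan Y) (mid (Lan_arr (X, \<eta>, Y)))"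
proof (rule psh_natI[where h = "\<lambda>c. mid (mid (Lan_arr (X, \<eta>, Y)) c)"], goal_cases)
  case (5 c)
  have "mid (mid (Lan_arr (X, \<eta>, Y)) c) E \<in> lan_set B B' K Y c" if "E \<in> lan_set B B' K X c" for E
    using that 5 psh_nat_PiE[OF assms, THEN PiE_mem]
    by (auto elim!: lan_setE simp: lan_arr_cls[OF assms] intro!: cls_in)
  with 5 show ?case
    by (auto simp: lan_arr_def fob_lan)
next
  case (6 w E)
  then have "E \<in> lan_set B B' K X (Cod B' w)"
    by (simp add: fob_lan)
  with 6 show ?case
    using psh_nat_PiE[OF assms, THEN PiE_mem]
    by (auto elim!: lan_setE simp: lan_act_cls lan_arr_cls[OF assms])
qed (auto simp: is_psh_lan lan_arr_def fob_lan)

lemma lan_arr_eq: "Lan_arr (X, \<eta>, Y) = (Lan X, mid (Lan_arr (X, \<eta>, Y)), Lan Y)"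
  by (simp add: lan_arr_def)

lemma lan_arr_in:
  assumes "m \<in> Arr (psh_cat B)"
  shows "Lan_arr m \<in> Arr (psh_cat B')"
    and "Dom (psh_cat B') (Lan_arr m) = Lan (Dom (psh_cat B) m)"
    and "Cod (psh_cat B') (Lan_arr m) = Lan (Cod (psh_cat B) m)"
proof -
  obtain X \<eta> Y where m: "m = (X, \<eta>, Y)" by (cases m)
  have "nat_trans (op_cat B') set_cat (Lan X) (Lan Y) (mid (Lan_arr m))"
    using assms lan_arr_nat_trans unfolding psh_cat_def m by simp
  moreover obtain \<theta> where "Lan_arr m = (Lan X, \<theta>, Lan Y)"
    unfolding m by (metis lan_arr_eq)
  ultimately show "Lan_arr m \<in> Arr (psh_cat B')"
    "Dom (psh_cat B') (Lan_arr m) = Lan (Dom (psh_cat B) m)"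
    "Cod (psh_cat B') (Lan_arr m) = Lan (Cod (psh_cat B) m)"
    unfolding psh_cat_def by (simp_all add: m)
qed

end

lemma psh_Cmp_apply:
  assumes "m \<in> Arr (psh_cat B)" "n \<in> Arr (psh_cat B)" "Dom (psh_cat B) n = Cod (psh_cat B) m"
    and "b \<in> Ob B" "x \<in> fob (Dom (psh_cat B) m) b"
  shows "mid (mid (Cmp (psh_cat B) n m) b) x = mid (mid n b) (mid (mid m b) x)"
proof -
  obtain X \<eta> Y where m: "m = (X, \<eta>, Y)" by (cases m)
  obtain \<theta> Z where n: "n = (Y, \<theta>, Z)" using assms(3) m by (cases n) (simp add: psh_cat_def)
  have nt: "nat_trans (op_cat B) set_cat X Y \<eta>" "nat_trans (op_cat B) set_cat Y Z \<theta>"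
    using assms(1,2) by (simp_all add: m n psh_cat_def)
  have "\<eta> b \<in> Arr set_cat" "\<theta> b \<in> Arr set_cat" "Dom set_cat (\<eta> b) = fob X b"
    using nt[THEN nat_trans.nt_PiE] nat_trans.nt_Dom[OF nt(1), of b] assms(4) by auto
  then show ?thesis
    using assms(4,5) by (simp add: m n psh_cat_def mid_Cmp_set_cat compose_def)
qed

text \<open>Extensionality enters twice, in the element within each component and in the object
  within the family of components.\<close>

lemma psh_arr_eqI:
  assumes "m \<in> Arr (psh_cat B)" "n \<in> Arr (psh_cat B)"
    and "Dom (psh_cat B) m = Dom (psh_cat B) n" "Cod (psh_cat B) m = Cod (psh_cat B) n"
    and eq: "\<And>b x. b \<in> Ob B \<Longrightarrow> x \<in> fob (Dom (psh_cat B) m) b \<Longrightarrow> mid (mid m b) x = mid (mid n b) x"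
  shows "m = n"
proof -
  obtain X \<eta> Y where m: "m = (X, \<eta>, Y)" by (cases m)
  obtain \<theta> where n: "n = (X, \<theta>, Y)" using assms(3,4) m by (cases n) (simp add: psh_cat_def)
  have nt: "nat_trans (op_cat B) set_cat X Y \<eta>" "nat_trans (op_cat B) set_cat X Y \<theta>"
    using assms(1,2) by (simp_all add: m n psh_cat_def)
  have "mid (\<eta> b) = mid (\<theta> b)" if "b \<in> Ob B" for b
    by (rule PiE_ext[OF psh_nat_PiE[OF nt(1) that] psh_nat_PiE[OF nt(2) that]])
      (use eq that in \<open>simp add: m n psh_cat_def\<close>)
  then have "\<eta> b = \<theta> b" if "b \<in> Ob B" for b
    using psh_nat_eq[OF nt(1) that] psh_nat_eq[OF nt(2) that] that by simp
  then have "\<eta> = \<theta>"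
    using PiE_ext[OF nat_trans.nt_PiE[OF nt(1)] nat_trans.nt_PiE[OF nt(2)]] by simp
  then show ?thesis by (simp add: m n)
qed

context kan
begin

lemma lan_arr_Idt:
  assumes "is_psh B X"
  shows "Lan_arr (Idt (psh_cat B) X) = Idt (psh_cat B') (Lan X)"
proof -
  interpret PB: category "psh_cat B" by (rule category_psh_cat) (rule S.category_axioms)
  interpret PB': category "psh_cat B'" by (rule category_psh_cat) (rule T.category_axioms)
  have X: "X \<in> Ob (psh_cat B)" and LX: "Lan X \<in> Ob (psh_cat B')"
    using assms is_psh_lan by (simp_all add: psh_cat_def)
  have nt: "nat_trans (op_cat B) set_cat X X (\<lambda>x\<in>Ob B. Idt set_cat (fob X x))"
    using PB.Idt_in[OF X] by (simp add: psh_cat_def)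
  show ?thesis
  proof (rule psh_arr_eqI)
    fix c E assume c: "c \<in> Ob B'" and "E \<in> fob (Dom (psh_cat B') (Lan_arr (Idt (psh_cat B) X))) c"
    then have E: "E \<in> lan_set B B' K X c"
      by (simp add: lan_arr_in X fob_lan)
    then obtain b u x where e: "(b, u, x) \<in> gen X c" "E = cls X c (b, u, x)"
      by (rule lan_setE)
    then show "mid (mid (Lan_arr (Idt (psh_cat B) X)) c) E = mid (mid (Idt (psh_cat B') (Lan X)) c) E"
      using c E lan_arr_cls[OF nt c e(1)] by (simp add: psh_cat_def fob_lan)
  qed (simp_all add: lan_arr_in X LX)
qed

text \<open>On a representative both sides only change the last entry, where they apply the
  components of \<open>m\<close> and \<open>n\<close> in succession.\<close>

lemma lan_arr_Cmp:
  assumes m: "m \<in> Arr (psh_cat B)" and n: "n \<in> Arr (psh_cat B)"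
    and "Dom (psh_cat B) n = Cod (psh_cat B) m"
  shows "Lan_arr (Cmp (psh_cat B) n m) = Cmp (psh_cat B') (Lan_arr n) (Lan_arr m)"
proof -
  interpret PB: category "psh_cat B" by (rule category_psh_cat) (rule S.category_axioms)
  interpret PB': category "psh_cat B'" by (rule category_psh_cat) (rule T.category_axioms)
  obtain X \<eta> Y where m_eq: "m = (X, \<eta>, Y)" by (cases m)
  obtain \<theta> Z where n_eq: "n = (Y, \<theta>, Z)" using assms(3) m_eq by (cases n) (simp add: psh_cat_def)
  have nt: "nat_trans (op_cat B) set_cat X Y \<eta>" "nat_trans (op_cat B) set_cat Y Z \<theta>"
    using assms(1,2) by (simp_all add: m_eq n_eq psh_cat_def)
  \<comment> \<open>The middle part of the composite stays opaque, so that
    \<open>lan_arr_cls\<close> applies to it as to any transformation.\<close>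
  obtain \<kappa> where nm: "Cmp (psh_cat B) n m = (X, \<kappa>, Z)"
    by (simp add: m_eq n_eq psh_cat_def)
  have nt': "nat_trans (op_cat B) set_cat X Z \<kappa>"
    using PB.Cmp_in[OF assms] by (simp add: nm) (simp add: psh_cat_def)
  show ?thesis
  proof (rule psh_arr_eqI)
    fix c E assume c: "c \<in> Ob B'" and "E \<in> fob (Dom (psh_cat B') (Lan_arr (Cmp (psh_cat B) n m))) c"
    then have E: "E \<in> lan_set B B' K X c"
      using assms by (simp add: lan_arr_in fob_lan) (simp add: psh_cat_def m_eq)
    then obtain b u x where e: "(b, u, x) \<in> gen X c" "E = cls X c (b, u, x)"
      by (rule lan_setE)
    have e': "(b, u, mid (\<eta> b) x) \<in> gen Y c"
      using e(1) psh_nat_PiE[OF nt(1)] by auto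
    have "mid (\<kappa> b) x = mid (\<theta> b) (mid (\<eta> b) x)"
      using psh_Cmp_apply[OF assms, of b x] e by (simp add: nm) (simp add: m_eq n_eq psh_cat_def)
    moreover have "mid (mid (Cmp (psh_cat B') (Lan_arr n) (Lan_arr m)) c) E
      = mid (mid (Lan_arr n) c) (mid (mid (Lan_arr m) c) E)"
      using assms c E by (intro psh_Cmp_apply) (simp_all add: lan_arr_in fob_lan, simp add: m_eq psh_cat_def)
    ultimately show "mid (mid (Lan_arr (Cmp (psh_cat B) n m)) c) E
      = mid (mid (Cmp (psh_cat B') (Lan_arr n) (Lan_arr m)) c) E"
      using c e lan_arr_cls[OF nt' c e(1)] lan_arr_cls[OF nt(1) c e(1)] lan_arr_cls[OF nt(2) c e']
      unfolding nm by (simp add: m_eq n_eq)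
  qed (simp_all add: lan_arr_in assms)
qed

end

section \<open>The coproduct is a 2-transducer\<close>

text \<open>The renaming \<open>j\<close> brings the extensions from both summands into one element
  type, as a single target transducer requires.\<close>

locale kan_rename = kan B B' K
  for B :: "('o, 'm) cat" and B' :: "('p, 'n) cat" and K :: "('o, 'm, 'p, 'n) func" +
  fixes j :: "('o \<times> 'n \<times> 'x) set \<Rightarrow> 'z"
  assumes inj_j: "inj j"
begin

definition Ext :: "('o, 'm, 'x) presheaf \<Rightarrow> ('p, 'n, 'z) presheaf"
  where "Ext X = fun_comp (op_cat B') (rename_fun j) (Lan X)"

definition Ext_arr :: "('o, 'm, 'x) presheaf_arr \<Rightarrow> ('p, 'n, 'z) presheaf_arr"
  where "Ext_arr m = postcomp_arr (op_cat B') (rename_fun j) (Lan_arr m)"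

lemma is_psh_Ext: "is_psh B' (Ext X)"
  unfolding Ext_def by (rule cat_functor_fun_comp[OF is_psh_lan cat_functor_rename_fun[OF inj_j]])

lemma Ext_arr_in:
  assumes "m \<in> Arr (psh_cat B)"
  shows "Ext_arr m \<in> Arr (psh_cat B')"
    and "Dom (psh_cat B') (Ext_arr m) = Ext (Dom (psh_cat B) m)"
    and "Cod (psh_cat B') (Ext_arr m) = Ext (Cod (psh_cat B) m)"
  using postcomp_arr_in[OF _ cat_functor_rename_fun[OF inj_j]] lan_arr_in[OF assms]
  unfolding psh_cat_def Ext_def Ext_arr_def by metis+

lemma Ext_arr_Idt:
  assumes "is_psh B X"
  shows "Ext_arr (Idt (psh_cat B) X) = Idt (psh_cat B') (Ext X)"
  using postcomp_arr_Idt[OF is_psh_lan cat_functor_rename_fun[OF inj_j]] lan_arr_Idt[OF assms]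
  unfolding Ext_def Ext_arr_def by (simp add: psh_cat_def)

lemma Ext_arr_Cmp:
  assumes "m \<in> Arr (psh_cat B)" "n \<in> Arr (psh_cat B)" "Dom (psh_cat B) n = Cod (psh_cat B) m"
  shows "Ext_arr (Cmp (psh_cat B) n m) = Cmp (psh_cat B') (Ext_arr n) (Ext_arr m)"
  unfolding Ext_arr_def lan_arr_Cmp[OF assms]
  unfolding psh_cat_def[of B']
  by (intro postcomp_arr_Cmp cat_functor_rename_fun[OF inj_j])
    (use lan_arr_in[OF assms(1)] lan_arr_in[OF assms(2)] assms(3) in \<open>simp_all add: psh_cat_def\<close>)

lemma fob_Ext: "c \<in> Ob B' \<Longrightarrow> fob (Ext X) c = j ` lan_set B B' K X c"
  unfolding Ext_def by (simp add: fun_comp_rename[OF is_psh_lan] fob_lan)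

lemma fob_ExtE:
  assumes "z \<in> fob (Ext X) c" "c \<in> Ob B'"
  obtains b u x where "(b, u, x) \<in> gen X c" "z = j (cls X c (b, u, x))"
  using assms by (auto simp: fob_Ext elim!: lan_setE)

lemma Ext_act_cls:
  assumes "w \<in> Arr B'" "(b, u, x) \<in> gen X (Cod B' w)"
  shows "mid (far (Ext X) w) (j (cls X (Cod B' w) (b, u, x))) = j (cls X (Dom B' w) (b, Cmp B' u w, x))"
  using assms unfolding Ext_def
  by (subst fun_comp_rename(2)[OF is_psh_lan inj_j]) (auto simp: fob_lan lan_act_cls intro!: cls_in)

lemma Ext_arr_cls:
  assumes "nat_trans (op_cat B) set_cat X Y \<eta>" "c \<in> Ob B'" "(b, u, x) \<in> gen X c"
  shows "mid (mid (Ext_arr (X, \<eta>, Y)) c) (j (cls X c (b, u, x))) = j (cls Y c (b, u, mid (\<eta> b) x))"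
proof -
  have "cls X c (b, u, x) \<in> fob (Lan X) c"
    using assms(2,3) by (simp only: fob_lan) (rule cls_in)
  from postcomp_rename[OF lan_arr_nat_trans[OF assms(1)] inj_j assms(2) this]
  show ?thesis
    unfolding Ext_arr_def lan_arr_cls[OF assms] lan_arr_eq[symmetric] .
qed

end


lemma is_psh_empty_psh:
  assumes "category B"
  shows "is_psh B (empty_psh B)"
proof -
  interpret category B by fact
  show ?thesis
    \<comment> \<open>The constant \<open>undefined\<close> is the one function that is extensional
      on the empty set.\<close>
    by (rule pshI[where h = "\<lambda>v x. undefined"]) (auto simp: empty_psh_def category_axioms)
qed

section \<open>The two actions of a 2-transducer on elements\<close>

lemma two_transducer_facts:
  assumes "two_transducer A B S"
  shows transducer_category: "category A" "category B" "category (St S)"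
    and transducer_functor: "cat_functor (idx_cat A (St S)) (psh_cat (star_cat B)) (Tr S)"
    and transducer_psh: "i \<in> Ob (idx_cat A (St S)) \<Longrightarrow> is_psh (star_cat B) (fob (Tr S) i)"
proof -
  show "category A" "category B" "category (St S)"
    and F: "cat_functor (idx_cat A (St S)) (psh_cat (star_cat B)) (Tr S)"
    using assms by (auto simp: two_transducer_def)
  show "i \<in> Ob (idx_cat A (St S)) \<Longrightarrow> is_psh (star_cat B) (fob (Tr S) i)"
    using cat_functor.fob_in[OF F, of i] by (simp add: psh_cat_def)
qed

lemma transducer_arrE:
  assumes "two_transducer A B S" "f \<in> Arr (idx_cat A (St S))"
  obtains \<eta> where "far (Tr S) f =
      (fob (Tr S) (Dom (idx_cat A (St S)) f), \<eta>, fob (Tr S) (Cod (idx_cat A (St S)) f))"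
    and "nat_trans (op_cat (star_cat B)) set_cat (fob (Tr S) (Dom (idx_cat A (St S)) f))
      (fob (Tr S) (Cod (idx_cat A (St S)) f)) \<eta>"
proof -
  interpret F: cat_functor "idx_cat A (St S)" "psh_cat (star_cat B)" "Tr S"
    by (rule transducer_functor[OF assms(1)])
  show ?thesis
    using F.far_in[OF assms(2)] F.far_Dom[OF assms(2)] F.far_Cod[OF assms(2)] that
    by (cases "far (Tr S) f") (simp add: psh_cat_def)
qed

lemma act_in_PiE:
  assumes "two_transducer A B S" "f \<in> Arr (idx_cat A (St S))" "b \<in> Ob (star_cat B)"
  shows "act_in S f b \<in> val S (Dom (idx_cat A (St S)) f) b \<rightarrow>\<^sub>E val S (Cod (idx_cat A (St S)) f) b"
proof -
  obtain \<eta> where "far (Tr S) f =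
      (fob (Tr S) (Dom (idx_cat A (St S)) f), \<eta>, fob (Tr S) (Cod (idx_cat A (St S)) f))"
    and "nat_trans (op_cat (star_cat B)) set_cat (fob (Tr S) (Dom (idx_cat A (St S)) f))
      (fob (Tr S) (Cod (idx_cat A (St S)) f)) \<eta>"
    by (rule transducer_arrE[OF assms(1,2)])
  then show ?thesis
    using psh_nat_PiE[OF _ assms(3)] by (simp add: act_in_def val_def)
qed

lemma act_out_PiE:
  assumes "two_transducer A B S" "i \<in> Ob (idx_cat A (St S))" "u \<in> Arr (star_cat B)"
  shows "act_out S i u \<in> val S i (Cod (star_cat B) u) \<rightarrow>\<^sub>E val S i (Dom (star_cat B) u)"
  using psh_act_PiE[OF transducer_psh[OF assms(1,2)] assms(3)] by (simp add: act_out_def val_def)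

lemma act_out_Idt:
  assumes "two_transducer A B S" "i \<in> Ob (idx_cat A (St S))" "b \<in> Ob (star_cat B)" "x \<in> val S i b"
  shows "act_out S i (Idt (star_cat B) b) x = x"
  using psh_act_Idt[OF transducer_psh[OF assms(1,2)] assms(3)] assms(4) by (simp add: act_out_def val_def)

lemma act_out_Cmp:
  assumes "two_transducer A B S" "i \<in> Ob (idx_cat A (St S))"
    and "f \<in> Arr (star_cat B)" "g \<in> Arr (star_cat B)" "Dom (star_cat B) g = Cod (star_cat B) f"
    and "x \<in> val S i (Cod (star_cat B) g)"
  shows "act_out S i (Cmp (star_cat B) g f) x = act_out S i f (act_out S i g x)"
  using psh_act_Cmp[OF transducer_psh[OF assms(1,2)] assms(3-5)] assms(6) by (simp add: act_out_def val_def)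

text \<open>Naturality of the transformation \<open>far (Tr S) f\<close> at the arrow
  \<open>u\<close>.\<close>

lemma act_in_act_out:
  assumes "two_transducer A B S" "f \<in> Arr (idx_cat A (St S))" "u \<in> Arr (star_cat B)"
    and "x \<in> val S (Dom (idx_cat A (St S)) f) (Cod (star_cat B) u)"
  shows "act_in S f (Dom (star_cat B) u) (act_out S (Dom (idx_cat A (St S)) f) u x) =
    act_out S (Cod (idx_cat A (St S)) f) u (act_in S f (Cod (star_cat B) u) x)"
proof -
  obtain \<eta> where "far (Tr S) f =
      (fob (Tr S) (Dom (idx_cat A (St S)) f), \<eta>, fob (Tr S) (Cod (idx_cat A (St S)) f))"
    and "nat_trans (op_cat (star_cat B)) set_cat (fob (Tr S) (Dom (idx_cat A (St S)) f))
      (fob (Tr S) (Cod (idx_cat A (St S)) f)) \<eta>"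
    by (rule transducer_arrE[OF assms(1,2)])
  then show ?thesis
    using psh_nat_natural[OF _ assms(3)] assms(4) by (simp add: act_in_def act_out_def val_def)
qed


section \<open>Pure and mixed summands of the index category\<close>

abbreviation inL :: "'a \<times> 'p \<times> 'p \<Rightarrow> ('a + 'c) \<times> ('p + 'q) \<times> ('p + 'q)"
  where "inL \<equiv> map_prod Inl (map_prod Inl Inl)"

abbreviation inR :: "'c \<times> 'q \<times> 'q \<Rightarrow> ('a + 'c) \<times> ('p + 'q) \<times> ('p + 'q)"
  where "inR \<equiv> map_prod Inr (map_prod Inr Inr)"

text \<open>Of the eight summands of the index these are the six on which \<open>oplus\<close> takes
  the empty presheaf. The predicate serves objects and arrows alike.\<close>

definition mixed :: "('a + 'c) \<times> ('p + 'q) \<times> ('p + 'q) \<Rightarrow> bool"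
  where "mixed i \<longleftrightarrow> i \<notin> range inL \<and> i \<notin> range inR"

lemma not_mixed [simp]: "\<not> mixed (inL i)" "\<not> mixed (inR i)"
  by (auto simp: mixed_def)

lemma inL_neq_inR [simp]: "inL i \<noteq> inR i'" "inR i' \<noteq> inL i"
  by (cases i; cases i'; simp)+

lemma inL_inR_inject [simp]: "inL i = inL i' \<longleftrightarrow> i = i'" "inR k = inR k' \<longleftrightarrow> k = k'"
  by (cases i; cases i'; cases k; cases k'; simp)+

lemma inL_inR_cases [case_names left right mixed]:
  obtains i' where "i = inL i'" | i' where "i = inR i'" | "mixed i"
  unfolding mixed_def by (metis rangeE)

lemma mixed_iff: "mixed (a, p, p') \<longleftrightarrow> isl a \<noteq> isl p \<or> isl a \<noteq> isl p'"
  by (cases a; cases p; cases p') (auto simp: mixed_def map_prod_def image_iff)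

lemma idx_sum_cat_simps [simp]:
  fixes A :: "('a, 'am) cat" and C :: "('c, 'cm) cat" and P :: "('p, 'pm) cat" and Q :: "('q, 'qm) cat"
  defines "I \<equiv> idx_cat (sum_cat A C) (sum_cat P Q)"
  shows "inL i \<in> Ob I \<longleftrightarrow> i \<in> Ob (idx_cat A P)" "inR i' \<in> Ob I \<longleftrightarrow> i' \<in> Ob (idx_cat C Q)"
    and "inL f \<in> Arr I \<longleftrightarrow> f \<in> Arr (idx_cat A P)" "inR f' \<in> Arr I \<longleftrightarrow> f' \<in> Arr (idx_cat C Q)"
    and "Dom I (inL f) = inL (Dom (idx_cat A P) f)" "Dom I (inR f') = inR (Dom (idx_cat C Q) f')"
    and "Cod I (inL f) = inL (Cod (idx_cat A P) f)" "Cod I (inR f') = inR (Cod (idx_cat C Q) f')"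
    and "Idt I (inL i) = inL (Idt (idx_cat A P) i)" "Idt I (inR i') = inR (Idt (idx_cat C Q) i')"
    and "Cmp I (inL g) (inL f) = inL (Cmp (idx_cat A P) g f)"
    and "Cmp I (inR g') (inR f') = inR (Cmp (idx_cat C Q) g' f')"
  unfolding I_def
  by (cases i; cases i'; cases f; cases g; cases f'; cases g'; simp)+

text \<open>The structure maps of \<open>sum_cat\<close> keep the tag of each entry, and by
  \<open>mixed_iff\<close> the tags decide. Hence an arrow stays within one summand, and the functor
  laws of \<open>oplus\<close> can be checked summand by summand.\<close>

lemma mixed_idx_sum_cat:
  fixes A :: "('a, 'am) cat" and C :: "('c, 'cm) cat" and P :: "('p, 'pm) cat" and Q :: "('q, 'qm) cat"
  defines "I \<equiv> idx_cat (sum_cat A C) (sum_cat P Q)"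
  shows "mixed (Dom I f) \<longleftrightarrow> mixed f" "mixed (Cod I f) \<longleftrightarrow> mixed f" "mixed (Idt I i) \<longleftrightarrow> mixed i"
    and "mixed f \<Longrightarrow> Dom I g = Cod I f \<Longrightarrow> mixed (Cmp I g f)"
proof -
  have [simp]: "isl (Dom (sum_cat U V) h) = isl h" "isl (Cod (sum_cat U V) h) = isl h"
    "isl (Idt (sum_cat U V) x) = isl x" for U V h x
    by (cases h; cases x; simp)+
  \<comment> \<open>Equal tags are required, since \<open>Cmp\<close> is \<open>undefined\<close> on
    arrows from different summands; below they come from composability.\<close>
  have Cmp: "isl (Cmp (sum_cat U V) h k) = isl k" if "isl h = isl k" for U V h k
    using that by (cases h; cases k; simp)
  obtain f0 f1 f2 where f: "f = (f0, f1, f2)" by (cases f)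
  obtain g0 g1 g2 where g: "g = (g0, g1, g2)" by (cases g)
  obtain i0 i1 i2 where i: "i = (i0, i1, i2)" by (cases i)
  show "mixed (Dom I f) \<longleftrightarrow> mixed f" "mixed (Cod I f) \<longleftrightarrow> mixed f" "mixed (Idt I i) \<longleftrightarrow> mixed i"
    by (simp_all add: f i I_def mixed_iff)
  assume "mixed f" and eq: "Dom I g = Cod I f"
  have "isl g0 = isl f0" "isl g1 = isl f1" "isl g2 = isl f2"
    using eq arg_cong[of _ _ isl] by (cases g0; cases f0; cases g1; cases f1; cases g2; cases f2; simp add: f g I_def)+
  then show "mixed (Cmp I g f)"
    using \<open>mixed f\<close> by (simp add: f g I_def mixed_iff Cmp)
qed

locale transducer_pair =
  fixes A :: "('ao, 'am) cat" and B :: "('bo, 'bm) cat"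
    and C :: "('co, 'cm) cat" and D :: "('eo, 'em) cat"
    and S :: "('ao, 'am, 'po, 'pm, 'bo, 'bm, 'x) transducer"
    and T :: "('co, 'cm, 'qo, 'qm, 'eo, 'em, 'y) transducer"
  assumes S: "two_transducer A B S" and T: "two_transducer C D T"
begin

abbreviation "AC \<equiv> sum_cat A C"
abbreviation "BD \<equiv> sum_cat B D"
abbreviation "ST \<equiv> oplus A B S C D T"

sublocale A: category A by (rule transducer_category[OF S])
sublocale B: category B by (rule transducer_category[OF S])
sublocale P: category "St S" by (rule transducer_category[OF S])
sublocale C: category C by (rule transducer_category[OF T])
sublocale D: category D by (rule transducer_category[OF T])
sublocale Q: category "St T" by (rule transducer_category[OF T])

lemma category_AC: "category AC" and category_BD: "category BD"
  and category_PQ: "category (sum_cat (St S) (St T))"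
  by (intro category_sum_cat A.category_axioms B.category_axioms P.category_axioms
      C.category_axioms D.category_axioms Q.category_axioms)+

sublocale L: kan_rename "star_cat B" "star_cat BD" "star_fun B (inl_fun B)"
  "Inl :: ('bo list \<times> ('bm + 'em) list \<times> 'x) set \<Rightarrow>
    ('bo list \<times> ('bm + 'em) list \<times> 'x) set + ('eo list \<times> ('bm + 'em) list \<times> 'y) set"
  by (intro kan_rename.intro kan.intro kan_rename_axioms.intro cat_functor.cat_functor_star_fun
      cat_functor_inl_fun B.category_axioms D.category_axioms) simp

sublocale R: kan_rename "star_cat D" "star_cat BD" "star_fun D (inr_fun D)"
  "Inr :: ('eo list \<times> ('bm + 'em) list \<times> 'y) set \<Rightarrow>
    ('bo list \<times> ('bm + 'em) list \<times> 'x) set + ('eo list \<times> ('bm + 'em) list \<times> 'y) set"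
  by (intro kan_rename.intro kan.intro kan_rename_axioms.intro cat_functor.cat_functor_star_fun
      cat_functor_inr_fun B.category_axioms D.category_axioms) simp

lemma St_oplus: "St ST = sum_cat (St S) (St T)"
  by (simp add: oplus_def Let_def)

lemma fob_oplus: "fob (Tr ST) = (\<lambda>i\<in>Ob (idx_cat AC (St ST)). case i of
    (Inl a, Inl p, Inl p') \<Rightarrow> L.Ext (fob (Tr S) (a, p, p'))
  | (Inr c, Inr q, Inr q') \<Rightarrow> R.Ext (fob (Tr T) (c, q, q'))
  | _ \<Rightarrow> empty_psh (star_cat BD))"
  unfolding oplus_def Let_def L.Ext_def[abs_def] R.Ext_def[abs_def] by simp

lemma far_oplus: "far (Tr ST) = (\<lambda>f\<in>Arr (idx_cat AC (St ST)). case f of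
    (Inl f0, Inl g, Inl h) \<Rightarrow> L.Ext_arr (far (Tr S) (f0, g, h))
  | (Inr f0, Inr g, Inr h) \<Rightarrow> R.Ext_arr (far (Tr T) (f0, g, h))
  | _ \<Rightarrow> Idt (psh_cat (star_cat BD)) (empty_psh (star_cat BD)))"
  unfolding oplus_def Let_def L.Ext_arr_def[abs_def] R.Ext_arr_def[abs_def] by simp

lemma oplus_left:
  "i \<in> Ob (idx_cat A (St S)) \<Longrightarrow> fob (Tr ST) (inL i) = L.Ext (fob (Tr S) i)"
  "f \<in> Arr (idx_cat A (St S)) \<Longrightarrow> far (Tr ST) (inL f) = L.Ext_arr (far (Tr S) f)"
  by (cases i; cases f; simp add: fob_oplus far_oplus St_oplus)+

lemma oplus_right:
  "i \<in> Ob (idx_cat C (St T)) \<Longrightarrow> fob (Tr ST) (inR i) = R.Ext (fob (Tr T) i)"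
  "f \<in> Arr (idx_cat C (St T)) \<Longrightarrow> far (Tr ST) (inR f) = R.Ext_arr (far (Tr T) f)"
  by (cases i; cases f; simp add: fob_oplus far_oplus St_oplus)+

lemma oplus_mixed:
  "mixed i \<Longrightarrow> i \<in> Ob (idx_cat AC (St ST)) \<Longrightarrow> fob (Tr ST) i = empty_psh (star_cat BD)"
  "mixed f \<Longrightarrow> f \<in> Arr (idx_cat AC (St ST)) \<Longrightarrow>
    far (Tr ST) f = Idt (psh_cat (star_cat BD)) (empty_psh (star_cat BD))"
  by (auto simp: fob_oplus far_oplus mixed_iff split: sum.split prod.split)

lemma two_transducer_oplus: "two_transducer AC BD ST"
proof -
  interpret I: category "idx_cat AC (sum_cat (St S) (St T))"
    by (rule category_idx_cat[OF category_AC category_PQ])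
  interpret psh: category "psh_cat (star_cat BD)"
    by (intro category_psh_cat category_star_cat category_BD)
  interpret S: cat_functor "idx_cat A (St S)" "psh_cat (star_cat B)" "Tr S"
    by (rule transducer_functor[OF S])
  interpret T: cat_functor "idx_cat C (St T)" "psh_cat (star_cat D)" "Tr T"
    by (rule transducer_functor[OF T])
  let ?I = "idx_cat AC (sum_cat (St S) (St T))"
  let ?E = "empty_psh (star_cat BD) :: ((('bo + 'eo) list, ('bm + 'em) list,
      ('bo list \<times> ('bm + 'em) list \<times> 'x) set + ('eo list \<times> ('bm + 'em) list \<times> 'y) set) presheaf)"
  have psh [simp]: "X \<in> Ob (psh_cat (star_cat BD)) \<longleftrightarrow> is_psh (star_cat BD) X" for X ::
    "(('bo + 'eo) list, ('bm + 'em) list,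
      ('bo list \<times> ('bm + 'em) list \<times> 'x) set + ('eo list \<times> ('bm + 'em) list \<times> 'y) set) presheaf"
    by (simp add: psh_cat_def)
  have E: "is_psh (star_cat BD) ?E"
    by (intro is_psh_empty_psh category_star_cat category_BD)
  \<comment> \<open>All mixed arrows act as this identity, so preservation of their composites
    amounts to its idempotence.\<close>
  have E_idem: "Cmp (psh_cat (star_cat BD)) (Idt (psh_cat (star_cat BD)) ?E) (Idt (psh_cat (star_cat BD)) ?E)
      = Idt (psh_cat (star_cat BD)) ?E"
    using psh.Cmp_Idt_right[of "Idt (psh_cat (star_cat BD)) ?E"] E by simp
  note simps = oplus_left oplus_right oplus_mixed[unfolded St_oplus] mixed_idx_sum_cat
    E L.is_psh_Ext R.is_psh_Ext L.Ext_arr_in R.Ext_arr_in S.far_Dom S.far_Cod T.far_Dom T.far_Cod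
  have "cat_functor ?I (psh_cat (star_cat BD)) (Tr ST)"
  proof
    have "fob (Tr ST) i \<in> Ob (psh_cat (star_cat BD))" if "i \<in> Ob ?I" for i
      using that by (cases i rule: inL_inR_cases) (simp_all add: simps)
    then show "fob (Tr ST) \<in> Ob ?I \<rightarrow>\<^sub>E Ob (psh_cat (star_cat BD))"
      by (auto simp: fob_oplus St_oplus)
    have "far (Tr ST) f \<in> Arr (psh_cat (star_cat BD))" if "f \<in> Arr ?I" for f
      using that by (cases f rule: inL_inR_cases) (simp_all add: simps)
    then show "far (Tr ST) \<in> Arr ?I \<rightarrow>\<^sub>E Arr (psh_cat (star_cat BD))"
      by (auto simp: far_oplus St_oplus)
    show "Dom (psh_cat (star_cat BD)) (far (Tr ST) f) = fob (Tr ST) (Dom ?I f)" if "f \<in> Arr ?I" for f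
      using that by (cases f rule: inL_inR_cases) (simp_all add: simps)
    show "Cod (psh_cat (star_cat BD)) (far (Tr ST) f) = fob (Tr ST) (Cod ?I f)" if "f \<in> Arr ?I" for f
      using that by (cases f rule: inL_inR_cases) (simp_all add: simps)
    show "far (Tr ST) (Idt ?I i) = Idt (psh_cat (star_cat BD)) (fob (Tr ST) i)" if "i \<in> Ob ?I" for i
      using that by (cases i rule: inL_inR_cases)
        (simp_all add: simps S.far_Idt T.far_Idt L.Ext_arr_Idt R.Ext_arr_Idt
          transducer_psh[OF S] transducer_psh[OF T])
    show "far (Tr ST) (Cmp ?I g f) = Cmp (psh_cat (star_cat BD)) (far (Tr ST) g) (far (Tr ST) f)"
      if "f \<in> Arr ?I" "g \<in> Arr ?I" and eq: "Dom ?I g = Cod ?I f" for f g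
    proof (cases f rule: inL_inR_cases)
      case (left f')
      \<comment> \<open>Composability forces \<open>g\<close> into the summand of \<open>f\<close>:
        a \<open>g\<close> from the other pure summand has the wrong tags, and a mixed
        \<open>g\<close> has a mixed domain.\<close>
      moreover from this eq obtain g' where "g = inL g'"
        using mixed_idx_sum_cat(1)[of A C "St S" "St T" g] by (cases g rule: inL_inR_cases) auto
      ultimately show ?thesis
        using that by (simp add: simps S.far_Cmp L.Ext_arr_Cmp)
    next
      case (right f')
      moreover from this eq obtain g' where "g = inR g'"
        using mixed_idx_sum_cat(1)[of A C "St S" "St T" g] by (cases g rule: inL_inR_cases) auto
      ultimately show ?thesis
        using that by (simp add: simps T.far_Cmp R.Ext_arr_Cmp)
    next
      case mixed
      moreover from this have "mixed g"
        using eq by (metis mixed_idx_sum_cat(1,2))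
      ultimately show ?thesis
        using that by (simp add: simps E_idem)
    qed
  qed
  then show ?thesis
    by (simp add: two_transducer_def St_oplus category_AC category_BD category_PQ)
qed

end

section \<open>Extending a cell along the unit\<close>

lemma star_fun_comp:
  assumes "cat_functor B B' F"
  shows "b \<in> Ob (star_cat B) \<Longrightarrow>
      fob (star_fun B' G) (fob (star_fun B F) b) = fob (star_fun B (fun_comp B G F)) b"
    and "u \<in> Arr (star_cat B) \<Longrightarrow>
      far (star_fun B' G) (far (star_fun B F) u) = far (star_fun B (fun_comp B G F)) u"
proof -
  interpret cat_functor "star_cat B" "star_cat B'" "star_fun B F"
    by (rule cat_functor.cat_functor_star_fun[OF assms])
  show "b \<in> Ob (star_cat B) \<Longrightarrow>
      fob (star_fun B' G) (fob (star_fun B F) b) = fob (star_fun B (fun_comp B G F)) b"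
    using fob_in[of b] by (auto simp: star_fun_def fun_comp_def compose_def star_cat_simps)
  show "u \<in> Arr (star_cat B) \<Longrightarrow>
      far (star_fun B' G) (far (star_fun B F) u) = far (star_fun B (fun_comp B G F)) u"
    using far_in[of u] by (auto simp: star_fun_def fun_comp_def compose_def star_cat_simps)
qed

lemma is_cell_facts:
  assumes "is_cell A B S A' B' T \<sigma>"
  shows cell_functors: "cat_functor A A' (tight_src \<sigma>)" "cat_functor B B' (tight_tgt \<sigma>)"
      "cat_functor (St S) (St T) (state_fun \<sigma>)"
    and cell_component_PiE: "component \<sigma> \<in> (\<Pi>\<^sub>E i\<in>Ob (idx_cat A (St S)). \<Pi>\<^sub>E b\<in>Ob (star_cat B).
        val S i b \<rightarrow>\<^sub>E val T (idx_ob \<sigma> i) (fob (star_fun B (tight_tgt \<sigma>)) b))"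
    and cell_component_in: "\<lbrakk>i \<in> Ob (idx_cat A (St S)); b \<in> Ob (star_cat B); x \<in> val S i b\<rbrakk>
      \<Longrightarrow> component \<sigma> i b x \<in> val T (idx_ob \<sigma> i) (fob (star_fun B (tight_tgt \<sigma>)) b)"
    and cell_act_out: "\<lbrakk>i \<in> Ob (idx_cat A (St S)); u \<in> Arr (star_cat B); x \<in> val S i (Cod (star_cat B) u)\<rbrakk>
      \<Longrightarrow> component \<sigma> i (Dom (star_cat B) u) (act_out S i u x) =
        act_out T (idx_ob \<sigma> i) (far (star_fun B (tight_tgt \<sigma>)) u)
          (component \<sigma> i (Cod (star_cat B) u) x)"
    and cell_act_in: "\<lbrakk>f \<in> Arr (idx_cat A (St S)); b \<in> Ob (star_cat B);
        x \<in> val S (Dom (idx_cat A (St S)) f) b\<rbrakk>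
      \<Longrightarrow> component \<sigma> (Cod (idx_cat A (St S)) f) b (act_in S f b x) =
        act_in T (idx_ar \<sigma> f) (fob (star_fun B (tight_tgt \<sigma>)) b)
          (component \<sigma> (Dom (idx_cat A (St S)) f) b x)"
  using assms unfolding is_cell_def by (blast dest: PiE_mem)+

lemma cell_idx:
  assumes "is_cell A B S A' B' T \<sigma>"
  shows "i \<in> Ob (idx_cat A (St S)) \<Longrightarrow> idx_ob \<sigma> i \<in> Ob (idx_cat A' (St T))"
    and "f \<in> Arr (idx_cat A (St S)) \<Longrightarrow> idx_ar \<sigma> f \<in> Arr (idx_cat A' (St T))"
    and "f \<in> Arr (idx_cat A (St S)) \<Longrightarrow>
      Dom (idx_cat A' (St T)) (idx_ar \<sigma> f) = idx_ob \<sigma> (Dom (idx_cat A (St S)) f)"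
    and "f \<in> Arr (idx_cat A (St S)) \<Longrightarrow>
      Cod (idx_cat A' (St T)) (idx_ar \<sigma> f) = idx_ob \<sigma> (Cod (idx_cat A (St S)) f)"
proof -
  interpret F: cat_functor A A' "tight_src \<sigma>" by (rule cell_functors[OF assms])
  interpret U: cat_functor "St S" "St T" "state_fun \<sigma>" by (rule cell_functors[OF assms])
  show "i \<in> Ob (idx_cat A (St S)) \<Longrightarrow> idx_ob \<sigma> i \<in> Ob (idx_cat A' (St T))"
    by (cases i) (simp add: idx_ob_def)
  show "f \<in> Arr (idx_cat A (St S)) \<Longrightarrow> idx_ar \<sigma> f \<in> Arr (idx_cat A' (St T))"
    "f \<in> Arr (idx_cat A (St S)) \<Longrightarrow>
      Dom (idx_cat A' (St T)) (idx_ar \<sigma> f) = idx_ob \<sigma> (Dom (idx_cat A (St S)) f)"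
    "f \<in> Arr (idx_cat A (St S)) \<Longrightarrow>
      Cod (idx_cat A' (St T)) (idx_ar \<sigma> f) = idx_ob \<sigma> (Cod (idx_cat A (St S)) f)"
    by (cases f; simp add: idx_ob_def idx_ar_def F.far_Dom F.far_Cod U.far_Dom U.far_Cod)+
qed

lemma vcomp_simps:
  "tight_src (vcomp A B S \<tau> \<sigma>) = fun_comp A (tight_src \<tau>) (tight_src \<sigma>)"
  "tight_tgt (vcomp A B S \<tau> \<sigma>) = fun_comp B (tight_tgt \<tau>) (tight_tgt \<sigma>)"
  "state_fun (vcomp A B S \<tau> \<sigma>) = fun_comp (St S) (state_fun \<tau>) (state_fun \<sigma>)"
  "\<lbrakk>i \<in> Ob (idx_cat A (St S)); b \<in> Ob (star_cat B); x \<in> val S i b\<rbrakk> \<Longrightarrow>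
    component (vcomp A B S \<tau> \<sigma>) i b x =
      component \<tau> (idx_ob \<sigma> i) (fob (star_fun B (tight_tgt \<sigma>)) b) (component \<sigma> i b x)"
  by (simp_all add: vcomp_def compose_def)

lemma idx_ob_vcomp:
  "i \<in> Ob (idx_cat A (St S)) \<Longrightarrow> idx_ob (vcomp A B S \<tau> \<sigma>) i = idx_ob \<tau> (idx_ob \<sigma> i)"
  by (cases i; simp add: vcomp_def idx_ob_def fun_comp_def compose_def)

text \<open>One summand of the coproduct in isolation: \<open>W\<close> stands for
  \<open>oplus\<close>, the functors \<open>iA\<close>, \<open>iB\<close>, \<open>iP\<close> for the
  inclusions, and \<open>W\<close> is prescribed only on their image. The instances
  \<open>LE\<close> and \<open>RE\<close> give the two sides.\<close>

locale transducer_extension =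
  fixes A :: "('ao, 'am) cat" and B :: "('bo, 'bm) cat"
    and S :: "('ao, 'am, 'po, 'pm, 'bo, 'bm, 'x) transducer"
    and A' :: "('co, 'cm) cat" and B' :: "('eo, 'em) cat"
    and W :: "('co, 'cm, 'qo, 'qm, 'eo, 'em, 'y) transducer"
    and iA iB iP and j :: "('bo list \<times> 'em list \<times> 'x) set \<Rightarrow> 'y"
  assumes S: "two_transducer A B S" and W: "two_transducer A' B' W"
    and iA: "cat_functor A A' iA" and iB: "cat_functor B B' iB"
    and iP: "cat_functor (St S) (St W) iP" and inj: "inj j"
    and fob_W: "\<And>i. i \<in> Ob (idx_cat A (St S)) \<Longrightarrow>
      fob (Tr W) (map_prod (fob iA) (map_prod (fob iP) (fob iP)) i) =
        fun_comp (op_cat (star_cat B')) (rename_fun j)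
          (lan (star_cat B) (star_cat B') (star_fun B iB) (fob (Tr S) i))"
    and far_W: "\<And>f. f \<in> Arr (idx_cat A (St S)) \<Longrightarrow>
      far (Tr W) (map_prod (far iA) (map_prod (far iP) (far iP)) f) =
        postcomp_arr (op_cat (star_cat B')) (rename_fun j)
          (lan_arr (star_cat B) (star_cat B') (star_fun B iB) (far (Tr S) f))"
begin

sublocale kan_rename "star_cat B" "star_cat B'" "star_fun B iB" j
  by (intro kan_rename.intro kan.intro kan_rename_axioms.intro cat_functor.cat_functor_star_fun iB inj)

abbreviation "I \<equiv> idx_cat A (St S)"
abbreviation "K \<equiv> star_fun B iB"

text \<open>The common form of \<open>coproj_left\<close> and \<open>coproj_right\<close>, which are
  identified with its instances in \<open>coproj_left_eq\<close> and
  \<open>coproj_right_eq\<close>.\<close>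

definition unit ::
  "('ao, 'am, 'bo, 'bm, 'po, 'pm, 'x, 'co, 'cm, 'eo, 'em, 'qo, 'qm, 'y) cell"
  where "unit = \<lparr>tight_src = iA, tight_tgt = iB, state_fun = iP,
    component = (\<lambda>i\<in>Ob I. \<lambda>b\<in>Ob (star_cat B). \<lambda>x\<in>val S i b.
      j (cls (fob (Tr S) i) (fob K b) (b, Idt (star_cat B') (fob K b), x)))\<rparr>"

lemma unit_simps [simp]: "tight_src unit = iA" "tight_tgt unit = iB" "state_fun unit = iP"
  by (simp_all add: unit_def)

lemma component_unit:
  "\<lbrakk>i \<in> Ob I; b \<in> Ob (star_cat B); x \<in> val S i b\<rbrakk> \<Longrightarrow>
    component unit i b x = j (cls (fob (Tr S) i) (fob K b) (b, Idt (star_cat B') (fob K b), x))"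
  by (simp add: unit_def)

lemma fob_W_unit: "i \<in> Ob I \<Longrightarrow> fob (Tr W) (idx_ob unit i) = Ext (fob (Tr S) i)"
  using fob_W by (simp add: idx_ob_def Ext_def)

lemma far_W_unit: "f \<in> Arr I \<Longrightarrow> far (Tr W) (idx_ar unit f) = Ext_arr (far (Tr S) f)"
  using far_W by (simp add: idx_ar_def Ext_arr_def)

lemma val_WI:
  assumes "i \<in> Ob I" "c \<in> Ob (star_cat B')" "(b, u, x) \<in> gen (fob (Tr S) i) c"
  shows "j (cls (fob (Tr S) i) c (b, u, x)) \<in> val W (idx_ob unit i) c"
  using assms(1,2) cls_in[OF assms(3)] by (simp add: val_def fob_W_unit fob_Ext)

lemma val_WE:
  assumes "z \<in> val W (idx_ob unit i) c" "i \<in> Ob I" "c \<in> Ob (star_cat B')"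
  obtains b u x where "(b, u, x) \<in> gen (fob (Tr S) i) c" "z = j (cls (fob (Tr S) i) c (b, u, x))"
  using assms fob_ExtE[of z "fob (Tr S) i" c] by (auto simp: val_def fob_W_unit)

lemma act_out_W:
  assumes "i \<in> Ob I" "w \<in> Arr (star_cat B')"
    and "(b, u, x) \<in> gen (fob (Tr S) i) (Cod (star_cat B') w)"
  shows "act_out W (idx_ob unit i) w (j (cls (fob (Tr S) i) (Cod (star_cat B') w) (b, u, x))) =
    j (cls (fob (Tr S) i) (Dom (star_cat B') w) (b, Cmp (star_cat B') u w, x))"
  using Ext_act_cls[OF assms(2,3)] assms(1) by (simp add: act_out_def fob_W_unit)

lemma act_in_W:
  assumes "f \<in> Arr I" "c \<in> Ob (star_cat B')" "(b, u, x) \<in> gen (fob (Tr S) (Dom I f)) c"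
  shows "act_in W (idx_ar unit f) c (j (cls (fob (Tr S) (Dom I f)) c (b, u, x))) =
    j (cls (fob (Tr S) (Cod I f)) c (b, u, act_in S f b x))"
proof -
  obtain \<eta> where \<eta>: "far (Tr S) f = (fob (Tr S) (Dom I f), \<eta>, fob (Tr S) (Cod I f))"
    and nt: "nat_trans (op_cat (star_cat B)) set_cat (fob (Tr S) (Dom I f)) (fob (Tr S) (Cod I f)) \<eta>"
    by (rule transducer_arrE[OF S assms(1)])
  show ?thesis
    using Ext_arr_cls[OF nt assms(2,3)] assms(1) by (simp add: act_in_def far_W_unit \<eta>)
qed

lemma category_I: "category I"
  by (intro category_idx_cat transducer_category[OF S])

lemma unit_in_gen:
  assumes "i \<in> Ob I" "b \<in> Ob (star_cat B)" "x \<in> val S i b"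
  shows "(b, Idt (star_cat B') (fob K b), x) \<in> gen (fob (Tr S) i) (fob K b)"
  using assms by (simp add: val_def)

lemma is_cell_unit: "is_cell A B S A' B' W unit"
proof -
  interpret I: category I by (rule category_I)
  show ?thesis
    unfolding is_cell_def unit_simps
  proof (intro conjI ballI)
    have "component unit i b x \<in> val W (idx_ob unit i) (fob K b)"
      if "i \<in> Ob I" "b \<in> Ob (star_cat B)" "x \<in> val S i b" for i b x
      using that val_WI[OF _ _ unit_in_gen] by (simp add: component_unit)
    then show "component unit \<in> (\<Pi>\<^sub>E i\<in>Ob I. \<Pi>\<^sub>E b\<in>Ob (star_cat B).
        val S i b \<rightarrow>\<^sub>E val W (idx_ob unit i) (fob K b))"
      by (auto simp: unit_def)
  next
    fix i u x assume *: "i \<in> Ob I" "u \<in> Arr (star_cat B)" "x \<in> val S i (Cod (star_cat B) u)"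
    let ?X = "fob (Tr S) i"
    have x': "act_out S i u x \<in> val S i (Dom (star_cat B) u)"
      using act_out_PiE[OF S *(1,2)] *(3) by (rule PiE_mem)
    \<comment> \<open>Both sides of naturality are compared with the class of the triple whose arrow
      is \<open>far K u\<close>. Here it arises by precomposing the identity with
      \<open>far K u\<close>.\<close>
    have "act_out W (idx_ob unit i) (far K u) (component unit i (Cod (star_cat B) u) x)
        = j (cls ?X (fob K (Dom (star_cat B) u)) (Cod (star_cat B) u, far K u, x))"
      using * act_out_W[of i "far K u" "Cod (star_cat B) u" "Idt (star_cat B') (fob K (Cod (star_cat B) u))" x]
        unit_in_gen[of i "Cod (star_cat B) u" x] T.Cmp_Idt_left[of "far K u"]
      by (simp add: component_unit far_Dom far_Cod)
    \<comment> \<open>The coend relation for \<open>v := u\<close> at the identity of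
      \<open>fob K (Dom (star_cat B) u)\<close> trades the arrow \<open>far K u\<close> for the
      action of \<open>u\<close> on \<open>x\<close>.\<close>
    also have "\<dots> = component unit i (Dom (star_cat B) u) (act_out S i u x)"
      using * x' cls_step[of u "Idt (star_cat B') (fob K (Dom (star_cat B) u))" _ x ?X]
        T.Cmp_Idt_right[of "far K u"]
      by (simp add: component_unit far_Dom val_def act_out_def)
    finally show "component unit i (Dom (star_cat B) u) (act_out S i u x) =
      act_out W (idx_ob unit i) (far K u) (component unit i (Cod (star_cat B) u) x)" by simp
  next
    fix f b x assume *: "f \<in> Arr I" "b \<in> Ob (star_cat B)" "x \<in> val S (Dom I f) b"
    then have "act_in S f b x \<in> val S (Cod I f) b"
      using act_in_PiE[OF S *(1,2)] by auto
    then show "component unit (Cod I f) b (act_in S f b x) =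
      act_in W (idx_ar unit f) (fob K b) (component unit (Dom I f) b x)"
      using * act_in_W[of f "fob K b" b "Idt (star_cat B') (fob K b)" x] unit_in_gen[of "Dom I f" b x]
      by (simp add: component_unit)
  qed (fact iA iB iP)+
qed

end

text \<open>The functor \<open>G\<close> is a parameter, tied to \<open>\<sigma>\<close> only by its
  restriction along \<open>iB\<close>: on the whole coproduct it is the copairing, which depends on
  the cell out of the other summand too.\<close>

locale cell_extension = transducer_extension A B S A' B' W iA iB iP j
  for A :: "('ao, 'am) cat" and B :: "('bo, 'bm) cat"
    and S :: "('ao, 'am, 'po, 'pm, 'bo, 'bm, 'x) transducer"
    and A' :: "('co, 'cm) cat" and B' :: "('eo, 'em) cat"
    and W :: "('co, 'cm, 'qo, 'qm, 'eo, 'em, 'y) transducer"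
    and iA iB iP and j :: "('bo list \<times> 'em list \<times> 'x) set \<Rightarrow> 'y" +
  fixes X :: "('xo, 'xm) cat" and Y :: "('yo, 'ym) cat"
    and R :: "('xo, 'xm, 'ro, 'rm, 'yo, 'ym, 'z) transducer" and \<sigma> and G
  assumes R: "two_transducer X Y R" and \<sigma>: "is_cell A B S X Y R \<sigma>"
    and G: "cat_functor B' Y G" and G_iB: "fun_comp B G iB = tight_tgt \<sigma>"
begin

abbreviation "G' \<equiv> star_fun B' G"

sublocale G': cat_functor "star_cat B'" "star_cat Y" G'
  by (rule cat_functor.cat_functor_star_fun[OF G])

text \<open>\<open>inv j z\<close> is a class of triples and \<open>SOME\<close> picks a
  representative; \<open>desc_cls\<close> shows that the choice does not matter.\<close>

definition desc :: "'ao \<times> 'po \<times> 'po \<Rightarrow> 'y \<Rightarrow> 'z"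
  where "desc i z = (let (b, u, x) = SOME e. e \<in> inv j z
    in act_out R (idx_ob \<sigma> i) (far G' u) (component \<sigma> i b x))"

text \<open>With these equations naturality of \<open>\<sigma>\<close>, which speaks of its own
  target functor, can be used for actions through \<open>G'\<close>.\<close>

lemma G'_K:
  "b \<in> Ob (star_cat B) \<Longrightarrow> fob G' (fob K b) = fob (star_fun B (tight_tgt \<sigma>)) b"
  "u \<in> Arr (star_cat B) \<Longrightarrow> far G' (far K u) = far (star_fun B (tight_tgt \<sigma>)) u"
  by (simp_all add: star_fun_comp[OF iB] G_iB)

lemma desc_cls:
  assumes i: "i \<in> Ob I" and e: "(b, u, x) \<in> gen (fob (Tr S) i) c"
  shows "desc i (j (cls (fob (Tr S) i) c (b, u, x))) =
    act_out R (idx_ob \<sigma> i) (far G' u) (component \<sigma> i b x)"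
proof -
  let ?X = "fob (Tr S) i"
  let ?h = "\<lambda>(b, u, x). act_out R (idx_ob \<sigma> i) (far G' u) (component \<sigma> i b x)"
  have step: "?h e = ?h e'" if "(e, e') \<in> lan_step (star_cat B) (star_cat B') K ?X c" for e e'
  proof -
    from that obtain v u x where *: "v \<in> Arr (star_cat B)" "u \<in> Arr (star_cat B')"
      "Dom (star_cat B') u = c" "Cod (star_cat B') u = fob K (Dom (star_cat B) v)"
      "x \<in> val S i (Cod (star_cat B) v)"
      and e: "e = (Cod (star_cat B) v, Cmp (star_cat B') (far K v) u, x)"
        "e' = (Dom (star_cat B) v, u, act_out S i v x)"
      unfolding lan_step_def val_def act_out_def by auto
    \<comment> \<open>Functoriality of \<open>G'\<close> and contravariance of the action split off
      the action of \<open>far G' (far K v)\<close>. Naturality of \<open>\<sigma>\<close> at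
      \<open>v\<close> carries it inside, where it becomes \<open>act_out S i v\<close>.\<close>
    have "?h e = act_out R (idx_ob \<sigma> i) (Cmp (star_cat Y) (far G' (far K v)) (far G' u))
        (component \<sigma> i (Cod (star_cat B) v) x)"
      using * by (simp add: e G'.far_Cmp far_Dom)
    also have "\<dots> = act_out R (idx_ob \<sigma> i) (far G' u)
        (act_out R (idx_ob \<sigma> i) (far G' (far K v)) (component \<sigma> i (Cod (star_cat B) v) x))"
      using * i cell_component_in[OF \<sigma> i _ *(5)]
      by (intro act_out_Cmp[OF R cell_idx(1)[OF \<sigma> i]])
        (simp_all add: G'.far_Dom G'.far_Cod far_Dom far_Cod flip: G'_K)
    also have "\<dots> = ?h e'"
      using * by (simp add: e G'_K cell_act_out[OF \<sigma> i])
    finally show ?thesis .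
  qed
  have "(SOME e. e \<in> cls ?X c (b, u, x)) \<in> cls ?X c (b, u, x)"
    using self_in_cls by (rule someI)
  then have "?h (b, u, x) = ?h (SOME e. e \<in> cls ?X c (b, u, x))"
    unfolding cls_def lan_rel_def by (intro eq_closure_invariant[OF _ step]) auto
  then show ?thesis
    by (simp add: desc_def inv_f_f[OF inj] Let_def)
qed

lemma desc_in:
  assumes "i \<in> Ob I" "c \<in> Ob (star_cat B')" "z \<in> val W (idx_ob unit i) c"
  shows "desc i z \<in> val R (idx_ob \<sigma> i) (fob G' c)"
proof -
  obtain b u x where e: "(b, u, x) \<in> gen (fob (Tr S) i) c" and z: "z = j (cls (fob (Tr S) i) c (b, u, x))"
    by (rule val_WE[OF assms(3,1,2)])
  have "component \<sigma> i b x \<in> val R (idx_ob \<sigma> i) (fob G' (fob K b))"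
    using cell_component_in[OF \<sigma> assms(1), of b x] e by (simp add: G'_K val_def)
  then show ?thesis
    using act_out_PiE[OF R cell_idx(1)[OF \<sigma> assms(1)], of "far G' u"] e
    by (auto simp: z desc_cls[OF assms(1) e] G'.far_Dom G'.far_Cod)
qed

text \<open>Acting by \<open>w\<close> replaces \<open>u\<close> by \<open>u\<close> after
  \<open>w\<close>, and the contravariant action of \<open>R\<close> turns this composite into the
  action of \<open>u\<close> followed by that of \<open>w\<close>.\<close>

lemma desc_act_out:
  assumes "i \<in> Ob I" "w \<in> Arr (star_cat B')" "z \<in> val W (idx_ob unit i) (Cod (star_cat B') w)"
  shows "desc i (act_out W (idx_ob unit i) w z) = act_out R (idx_ob \<sigma> i) (far G' w) (desc i z)"
proof -
  obtain b u x where e: "(b, u, x) \<in> gen (fob (Tr S) i) (Cod (star_cat B') w)"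
    and z: "z = j (cls (fob (Tr S) i) (Cod (star_cat B') w) (b, u, x))"
    using val_WE[OF assms(3,1)] assms(2) by auto
  have e': "(b, Cmp (star_cat B') u w, x) \<in> gen (fob (Tr S) i) (Dom (star_cat B') w)"
    using e assms by simp
  have "component \<sigma> i b x \<in> val R (idx_ob \<sigma> i) (fob G' (fob K b))"
    using cell_component_in[OF \<sigma> assms(1), of b x] e by (simp add: G'_K val_def)
  then show ?thesis
    using assms e
    by (simp add: z act_out_W[OF assms(1,2) e] desc_cls[OF assms(1) e] desc_cls[OF assms(1) e']
      G'.far_Cmp) (rule act_out_Cmp[OF R cell_idx(1)[OF \<sigma> assms(1)]];
        simp add: G'.far_Dom G'.far_Cod)
qed

text \<open>The arrow \<open>f\<close> touches only the last entry \<open>x\<close>. Naturality of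
  \<open>\<sigma>\<close> transports it to \<open>R\<close>, where it passes the action of
  \<open>far G' u\<close> by \<open>act_in_act_out\<close>.\<close>

lemma desc_act_in:
  assumes "f \<in> Arr I" "c \<in> Ob (star_cat B')" "z \<in> val W (idx_ob unit (Dom I f)) c"
  shows "desc (Cod I f) (act_in W (idx_ar unit f) c z) =
    act_in R (idx_ar \<sigma> f) (fob G' c) (desc (Dom I f) z)"
proof -
  interpret I: category I by (rule category_I)
  have ob: "Dom I f \<in> Ob I" "Cod I f \<in> Ob I"
    using assms(1) by simp_all
  obtain b u x where e: "(b, u, x) \<in> gen (fob (Tr S) (Dom I f)) c"
    and z: "z = j (cls (fob (Tr S) (Dom I f)) c (b, u, x))"
    by (rule val_WE[OF assms(3) ob(1) assms(2)])
  have x: "x \<in> val S (Dom I f) b" and b: "b \<in> Ob (star_cat B)"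
    using e by (auto simp: val_def)
  then have "act_in S f b x \<in> val S (Cod I f) b"
    using act_in_PiE[OF S assms(1) b] by auto
  then have e': "(b, u, act_in S f b x) \<in> gen (fob (Tr S) (Cod I f)) c"
    using e by (simp add: val_def)
  have "component \<sigma> (Dom I f) b x \<in> val R (Dom (idx_cat X (St R)) (idx_ar \<sigma> f)) (Cod (star_cat Y) (far G' u))"
    using cell_component_in[OF \<sigma> ob(1) b x] e assms(1) by (simp add: G'_K G'.far_Cod cell_idx(3)[OF \<sigma>])
  from act_in_act_out[OF R cell_idx(2)[OF \<sigma> assms(1)] _ this] show ?thesis
    using e assms(1)
    by (simp add: z act_in_W[OF assms(1,2) e] desc_cls[OF ob(1) e] desc_cls[OF ob(2) e']
      cell_act_in[OF \<sigma> assms(1) b x] cell_idx[OF \<sigma>] G'.far_Dom G'.far_Cod G'_K)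
qed

text \<open>The representative given by the unit has an identity as its arrow, so the action through
  \<open>G'\<close> is trivial.\<close>

lemma desc_unit:
  assumes "i \<in> Ob I" "b \<in> Ob (star_cat B)" "x \<in> val S i b"
  shows "desc i (component unit i b x) = component \<sigma> i b x"
  using act_out_Idt[OF R cell_idx(1)[OF \<sigma> assms(1)] _ cell_component_in[OF \<sigma> assms]] assms(2)
    G'.fob_in[of "fob K b"]
  by (simp add: component_unit[OF assms] desc_cls[OF assms(1) unit_in_gen[OF assms]]
    G'.far_Idt G'_K)

text \<open>Uniqueness on one summand. The assumption on \<open>tight_tgt \<chi>\<close> ensures
  that the action on the side of \<open>R\<close> is taken along the same \<open>far G' u\<close> as
  in \<open>desc\<close>.\<close>

lemma component_eq_desc:
  assumes \<chi>: "is_cell A' B' W X Y R \<chi>" and eq: "vcomp A B S \<chi> unit = \<sigma>" and tgt: "tight_tgt \<chi> = G"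
    and i: "i \<in> Ob I" and c: "c \<in> Ob (star_cat B')" and z: "z \<in> val W (idx_ob unit i) c"
  shows "component \<chi> (idx_ob unit i) c z = desc i z"
proof -
  obtain b u x where e: "(b, u, x) \<in> gen (fob (Tr S) i) c" and z: "z = j (cls (fob (Tr S) i) c (b, u, x))"
    by (rule val_WE[OF z i c])
  have x: "x \<in> val S i b" and b: "b \<in> Ob (star_cat B)"
    and u: "u \<in> Arr (star_cat B')" "Dom (star_cat B') u = c" "Cod (star_cat B') u = fob K b"
    using e by (auto simp: val_def)
  have "z = act_out W (idx_ob unit i) u (component unit i b x)"
    using act_out_W[OF i u(1), of b "Idt (star_cat B') (fob K b)" x] unit_in_gen[OF i b x] u
      T.Cmp_Idt_left[OF u(1)]
    by (simp add: component_unit[OF i b x] z)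
  then have "component \<chi> (idx_ob unit i) c z =
      act_out R (idx_ob \<chi> (idx_ob unit i)) (far G' u) (component \<chi> (idx_ob unit i) (fob K b) (component unit i b x))"
    using cell_act_out[OF \<chi> cell_idx(1)[OF is_cell_unit i] u(1), of "component unit i b x"]
      cell_component_in[OF is_cell_unit i b x] u tgt by simp
  also have "idx_ob \<chi> (idx_ob unit i) = idx_ob \<sigma> i"
    using idx_ob_vcomp[OF i, of B \<chi> unit] eq by simp
  also have "component \<chi> (idx_ob unit i) (fob K b) (component unit i b x) = component \<sigma> i b x"
    using vcomp_simps(4)[OF i b x, of \<chi> unit] eq by simp
  finally show ?thesis
    by (simp add: z desc_cls[OF i e])
qed

end

section \<open>The universal property\<close>

definition copair_fun ::
  "('o, 'm) cat \<Rightarrow> ('p, 'n) cat \<Rightarrow> ('o, 'm, 'q, 'k) func \<Rightarrow> ('p, 'n, 'q, 'k) func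
    \<Rightarrow> ('o + 'p, 'm + 'n, 'q, 'k) func"
  where "copair_fun C D F G =
    \<lparr>fob = restrict (case_sum (fob F) (fob G)) (Ob (sum_cat C D)),
     far = restrict (case_sum (far F) (far G)) (Arr (sum_cat C D))\<rparr>"

lemma copair_fun_simps [simp]:
  "x \<in> Ob C \<Longrightarrow> fob (copair_fun C D F G) (Inl x) = fob F x"
  "y \<in> Ob D \<Longrightarrow> fob (copair_fun C D F G) (Inr y) = fob G y"
  "f \<in> Arr C \<Longrightarrow> far (copair_fun C D F G) (Inl f) = far F f"
  "g \<in> Arr D \<Longrightarrow> far (copair_fun C D F G) (Inr g) = far G g"
  by (simp_all add: copair_fun_def)

lemma inl_inr_fun_simps [simp]:
  "x \<in> Ob C \<Longrightarrow> fob (inl_fun C) x = Inl x" "f \<in> Arr C \<Longrightarrow> far (inl_fun C) f = Inl f"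
  "x \<in> Ob C \<Longrightarrow> fob (inr_fun C) x = Inr x" "f \<in> Arr C \<Longrightarrow> far (inr_fun C) f = Inr f"
  by (simp_all add: inl_fun_def inr_fun_def)

lemma cat_functor_copair_fun:
  assumes "cat_functor C E F" "cat_functor D E G"
  shows "cat_functor (sum_cat C D) E (copair_fun C D F G)"
proof -
  interpret F: cat_functor C E F by fact
  interpret G: cat_functor D E G by fact
  interpret CD: category "sum_cat C D"
    by (intro category_sum_cat F.S.category_axioms G.S.category_axioms)
  have split: "(\<forall>z. P z) \<longleftrightarrow> (\<forall>x. P (Inl x)) \<and> (\<forall>y. P (Inr y))" for P :: "'u + 'v \<Rightarrow> bool"
    by (metis sum.exhaust)
  show ?thesis
  proof
    show "fob (copair_fun C D F G) \<in> Ob (sum_cat C D) \<rightarrow>\<^sub>E Ob E"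
      by (auto simp: copair_fun_def sum_cat_def)
    show "far (copair_fun C D F G) \<in> Arr (sum_cat C D) \<rightarrow>\<^sub>E Arr E"
      by (auto simp: copair_fun_def sum_cat_def)
  qed (unfold atomize_all atomize_imp,
    simp_all add: split F.far_Dom F.far_Cod F.far_Idt F.far_Cmp G.far_Dom G.far_Cod G.far_Idt G.far_Cmp)
qed

lemma func_eqI:
  assumes "cat_functor C D F" "cat_functor C D G"
    and "\<And>x. x \<in> Ob C \<Longrightarrow> fob F x = fob G x" "\<And>f. f \<in> Arr C \<Longrightarrow> far F f = far G f"
  shows "F = G"
proof -
  interpret F: cat_functor C D F by fact
  interpret G: cat_functor C D G by fact
  have "fob F = fob G" "far F = far G"
    using assms(3,4) by (auto intro: PiE_ext[OF F.fob_PiE G.fob_PiE] PiE_ext[OF F.far_PiE G.far_PiE])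
  then show ?thesis by simp
qed

lemma fun_comp_copair_fun:
  assumes F: "cat_functor C E F" and G: "cat_functor D E G"
  shows "fun_comp C (copair_fun C D F G) (inl_fun C) = F"
    and "fun_comp D (copair_fun C D F G) (inr_fun D) = G"
proof -
  interpret F: cat_functor C E F by fact
  interpret G: cat_functor D E G by fact
  note copair = cat_functor_copair_fun[OF F G]
  show "fun_comp C (copair_fun C D F G) (inl_fun C) = F"
    by (rule func_eqI[OF cat_functor_fun_comp[OF cat_functor_inl_fun copair] F])
      (simp_all add: fun_comp_def compose_def F.S.category_axioms G.S.category_axioms)
  show "fun_comp D (copair_fun C D F G) (inr_fun D) = G"
    by (rule func_eqI[OF cat_functor_fun_comp[OF cat_functor_inr_fun copair] G])
      (simp_all add: fun_comp_def compose_def F.S.category_axioms G.S.category_axioms)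
qed

lemma copair_fun_unique:
  assumes H: "cat_functor (sum_cat C D) E H" and cat: "category C" "category D"
  shows "H = copair_fun C D (fun_comp C H (inl_fun C)) (fun_comp D H (inr_fun D))"
proof (rule func_eqI[OF H])
  show "cat_functor (sum_cat C D) E (copair_fun C D (fun_comp C H (inl_fun C)) (fun_comp D H (inr_fun D)))"
    by (intro cat_functor_copair_fun cat_functor_fun_comp[OF _ H] cat_functor_inl_fun cat_functor_inr_fun cat)
qed (auto simp: sum_cat_def fun_comp_def compose_def copair_fun_def)

section \<open>Equality of cells from equality on elements\<close>

lemma cell_eqI:
  assumes "is_cell A B S X Y R \<sigma>" "is_cell A B S X Y R \<sigma>'"
    and "tight_src \<sigma> = tight_src \<sigma>'" "tight_tgt \<sigma> = tight_tgt \<sigma>'" "state_fun \<sigma> = state_fun \<sigma>'"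
    and eq: "\<And>i b x. \<lbrakk>i \<in> Ob (idx_cat A (St S)); b \<in> Ob (star_cat B); x \<in> val S i b\<rbrakk> \<Longrightarrow>
      component \<sigma> i b x = component \<sigma>' i b x"
  shows "\<sigma> = \<sigma>'"
proof -
  \<comment> \<open>\<open>PiE_ext\<close> compares members of one function space, while that of
    \<open>\<sigma>'\<close> is stated with its own index map and tight target.\<close>
  have "idx_ob \<sigma> = idx_ob \<sigma>'"
    using assms(3-5) by (simp add: idx_ob_def fun_eq_iff)
  then have PiE: "component \<sigma>' \<in> (\<Pi>\<^sub>E i\<in>Ob (idx_cat A (St S)). \<Pi>\<^sub>E b\<in>Ob (star_cat B).
        val S i b \<rightarrow>\<^sub>E val R (idx_ob \<sigma> i) (fob (star_fun B (tight_tgt \<sigma>)) b))"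
    using cell_component_PiE[OF assms(2)] assms(4) by simp
  have "component \<sigma> = component \<sigma>'"
  proof (rule PiE_ext[OF cell_component_PiE[OF assms(1)] PiE])
    fix i assume i: "i \<in> Ob (idx_cat A (St S))"
    note P = PiE_mem[OF cell_component_PiE[OF assms(1)] i] PiE_mem[OF PiE i]
    show "component \<sigma> i = component \<sigma>' i"
    proof (rule PiE_ext[OF P])
      fix b assume b: "b \<in> Ob (star_cat B)"
      show "component \<sigma> i b = component \<sigma>' i b"
        by (rule PiE_ext[OF PiE_mem[OF P(1) b] PiE_mem[OF P(2) b]]) (rule eq[OF i b])
    qed
  qed
  with assms(3-5) show ?thesis by simp
qed

text \<open>\<open>vcomp\<close> forms its component by nested restrictions; agreement on elements
  then suffices to recognise the composite as \<open>\<sigma>\<close>.\<close>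

lemma restrict_cell_component:
  assumes \<sigma>: "is_cell A B S X Y R \<sigma>"
    and eq: "\<And>i b x. \<lbrakk>i \<in> Ob (idx_cat A (St S)); b \<in> Ob (star_cat B); x \<in> val S i b\<rbrakk> \<Longrightarrow>
      h i b x = component \<sigma> i b x"
  shows "(\<lambda>i\<in>Ob (idx_cat A (St S)). \<lambda>b\<in>Ob (star_cat B). \<lambda>x\<in>val S i b. h i b x) = component \<sigma>"
proof (rule extensionalityI)
  note PiE = cell_component_PiE[OF \<sigma>]
  show "component \<sigma> \<in> extensional (Ob (idx_cat A (St S)))"
    using PiE by (simp add: PiE_def)
  fix i assume i: "i \<in> Ob (idx_cat A (St S))"
  have "(\<lambda>b\<in>Ob (star_cat B). \<lambda>x\<in>val S i b. h i b x) = component \<sigma> i"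
  proof (rule extensionalityI)
    show "component \<sigma> i \<in> extensional (Ob (star_cat B))"
      using PiE_mem[OF PiE i] by (simp add: PiE_def)
    fix b assume b: "b \<in> Ob (star_cat B)"
    have "(\<lambda>x\<in>val S i b. h i b x) = component \<sigma> i b"
    proof (rule extensionalityI)
      show "component \<sigma> i b \<in> extensional (val S i b)"
        using PiE_mem[OF PiE_mem[OF PiE i] b] by (simp add: PiE_def)
    qed (use eq[OF i b] in simp_all)
    with b show "(\<lambda>b\<in>Ob (star_cat B). \<lambda>x\<in>val S i b. h i b x) b = component \<sigma> i b" by simp
  qed simp
  with i show "(\<lambda>i\<in>Ob (idx_cat A (St S)). \<lambda>b\<in>Ob (star_cat B). \<lambda>x\<in>val S i b. h i b x) i = component \<sigma> i"
    by simp
qed simp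

section \<open>The coprojections as instances of the unit\<close>

context transducer_pair
begin

lemma inl_idx [simp]:
  "i \<in> Ob (idx_cat A (St S)) \<Longrightarrow>
    map_prod (fob (inl_fun A)) (map_prod (fob (inl_fun (St S))) (fob (inl_fun (St S)))) i = inL i"
  "f \<in> Arr (idx_cat A (St S)) \<Longrightarrow>
    map_prod (far (inl_fun A)) (map_prod (far (inl_fun (St S))) (far (inl_fun (St S)))) f = inL f"
  by (cases i; cases f; simp)+

lemma inr_idx [simp]:
  "i \<in> Ob (idx_cat C (St T)) \<Longrightarrow>
    map_prod (fob (inr_fun C)) (map_prod (fob (inr_fun (St T))) (fob (inr_fun (St T)))) i = inR i"
  "f \<in> Arr (idx_cat C (St T)) \<Longrightarrow>
    map_prod (far (inr_fun C)) (map_prod (far (inr_fun (St T))) (far (inr_fun (St T)))) f = inR f"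
  by (cases i; cases f; simp)+

sublocale LE: transducer_extension A B S AC BD ST "inl_fun A" "inl_fun B" "inl_fun (St S)" Inl
  by (rule transducer_extension.intro)
    (auto simp: S two_transducer_oplus St_oplus oplus_left L.Ext_def L.Ext_arr_def
      intro!: cat_functor_inl_fun A.category_axioms B.category_axioms C.category_axioms D.category_axioms
      P.category_axioms Q.category_axioms)

sublocale RE: transducer_extension C D T AC BD ST "inr_fun C" "inr_fun D" "inr_fun (St T)" Inr
  by (rule transducer_extension.intro)
    (auto simp: T two_transducer_oplus St_oplus oplus_right R.Ext_def R.Ext_arr_def
      intro!: cat_functor_inr_fun A.category_axioms B.category_axioms C.category_axioms D.category_axioms
      P.category_axioms Q.category_axioms)

lemma coproj_left_eq: "coproj_left A B S C D T = LE.unit"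
  by (simp add: coproj_left_def LE.unit_def Let_def L.cls_def)

lemma coproj_right_eq: "coproj_right A B S C D T = RE.unit"
  by (simp add: coproj_right_def RE.unit_def Let_def R.cls_def)

lemma idx_unit:
  "i \<in> Ob (idx_cat A (St S)) \<Longrightarrow> idx_ob LE.unit i = inL i"
  "f \<in> Arr (idx_cat A (St S)) \<Longrightarrow> idx_ar LE.unit f = inL f"
  "i' \<in> Ob (idx_cat C (St T)) \<Longrightarrow> idx_ob RE.unit i' = inR i'"
  "f' \<in> Arr (idx_cat C (St T)) \<Longrightarrow> idx_ar RE.unit f' = inR f'"
  by (simp_all add: idx_ob_def idx_ar_def)

lemma val_mixed:
  "mixed i \<Longrightarrow> i \<in> Ob (idx_cat AC (St ST)) \<Longrightarrow> c \<in> Ob (star_cat BD) \<Longrightarrow> val ST i c = {}"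
  by (simp add: val_def oplus_mixed empty_psh_def)

end

section \<open>The copairing of two cells and its uniqueness\<close>

locale transducer_cocone = transducer_pair A B C D S T
  for A :: "('ao, 'am) cat" and B :: "('bo, 'bm) cat"
    and C :: "('co, 'cm) cat" and D :: "('eo, 'em) cat"
    and S :: "('ao, 'am, 'po, 'pm, 'bo, 'bm, 'x) transducer"
    and T :: "('co, 'cm, 'qo, 'qm, 'eo, 'em, 'y) transducer" +
  fixes X :: "('xo, 'xm) cat" and Y :: "('yo, 'ym) cat"
    and R :: "('xo, 'xm, 'ro, 'rm, 'yo, 'ym, 'z) transducer" and \<sigma> \<tau>
  assumes R: "two_transducer X Y R" and \<sigma>: "is_cell A B S X Y R \<sigma>" and \<tau>: "is_cell C D T X Y R \<tau>"
begin

abbreviation "G \<equiv> copair_fun B D (tight_tgt \<sigma>) (tight_tgt \<tau>)"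

sublocale LC: cell_extension A B S AC BD ST "inl_fun A" "inl_fun B" "inl_fun (St S)" Inl X Y R \<sigma> G
  by (intro cell_extension.intro cell_extension_axioms.intro LE.transducer_extension_axioms R \<sigma>
      cat_functor_copair_fun fun_comp_copair_fun[OF cell_functors(2)[OF \<sigma>] cell_functors(2)[OF \<tau>]]
      cell_functors[OF \<sigma>] cell_functors[OF \<tau>])

sublocale RC: cell_extension C D T AC BD ST "inr_fun C" "inr_fun D" "inr_fun (St T)" Inr X Y R \<tau> G
  by (intro cell_extension.intro cell_extension_axioms.intro RE.transducer_extension_axioms R \<tau>
      cat_functor_copair_fun fun_comp_copair_fun[OF cell_functors(2)[OF \<sigma>] cell_functors(2)[OF \<tau>]]
      cell_functors[OF \<sigma>] cell_functors[OF \<tau>])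

text \<open>The default branch is reached only on mixed summands, where \<open>val ST i c\<close> is
  empty by \<open>val_mixed\<close>.\<close>

definition copair_cell where
  "copair_cell =
    \<lparr>tight_src = copair_fun A C (tight_src \<sigma>) (tight_src \<tau>), tight_tgt = G,
     state_fun = copair_fun (St S) (St T) (state_fun \<sigma>) (state_fun \<tau>),
     component = (\<lambda>i\<in>Ob (idx_cat AC (St ST)). \<lambda>c\<in>Ob (star_cat BD). \<lambda>z\<in>val ST i c.
       case i of
         (Inl a, Inl p, Inl p') \<Rightarrow> LC.desc (a, p, p') z
       | (Inr c, Inr q, Inr q') \<Rightarrow> RC.desc (c, q, q') z
       | _ \<Rightarrow> undefined)\<rparr>"

lemma copair_cell_simps [simp]:
  "tight_src copair_cell = copair_fun A C (tight_src \<sigma>) (tight_src \<tau>)"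
  "tight_tgt copair_cell = G"
  "state_fun copair_cell = copair_fun (St S) (St T) (state_fun \<sigma>) (state_fun \<tau>)"
  by (simp_all add: copair_cell_def)

lemma idx_copair_cell:
  "i \<in> Ob (idx_cat A (St S)) \<Longrightarrow> idx_ob copair_cell (inL i) = idx_ob \<sigma> i"
  "f \<in> Arr (idx_cat A (St S)) \<Longrightarrow> idx_ar copair_cell (inL f) = idx_ar \<sigma> f"
  "i' \<in> Ob (idx_cat C (St T)) \<Longrightarrow> idx_ob copair_cell (inR i') = idx_ob \<tau> i'"
  "f' \<in> Arr (idx_cat C (St T)) \<Longrightarrow> idx_ar copair_cell (inR f') = idx_ar \<tau> f'"
  by (cases i; cases f; cases i'; cases f'; simp add: idx_ob_def idx_ar_def)+

lemma component_copair_cell: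
  "\<lbrakk>i \<in> Ob (idx_cat A (St S)); c \<in> Ob (star_cat BD); z \<in> val ST (inL i) c\<rbrakk> \<Longrightarrow>
    component copair_cell (inL i) c z = LC.desc i z"
  "\<lbrakk>i' \<in> Ob (idx_cat C (St T)); c \<in> Ob (star_cat BD); z \<in> val ST (inR i') c\<rbrakk> \<Longrightarrow>
    component copair_cell (inR i') c z = RC.desc i' z"
  by (cases i; cases i'; simp add: copair_cell_def St_oplus)+

lemma is_cell_copair_cell: "is_cell AC BD ST X Y R copair_cell"
proof -
  let ?I = "idx_cat AC (St ST)"
  interpret BD: category "star_cat BD" by (intro category_star_cat category_BD)
  interpret IS: category "idx_cat A (St S)" by (rule LE.category_I)
  interpret IT: category "idx_cat C (St T)" by (rule RE.category_I)
  interpret IST: category ?I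
    unfolding St_oplus by (intro category_idx_cat category_AC category_PQ)
  note out_in = act_out_PiE[OF two_transducer_oplus, THEN PiE_mem]
    act_in_PiE[OF two_transducer_oplus, THEN PiE_mem]
  have inL: "inL i \<in> Ob ?I \<longleftrightarrow> i \<in> Ob (idx_cat A (St S))" "inR i' \<in> Ob ?I \<longleftrightarrow> i' \<in> Ob (idx_cat C (St T))"
    "inL f \<in> Arr ?I \<longleftrightarrow> f \<in> Arr (idx_cat A (St S))" "inR f' \<in> Arr ?I \<longleftrightarrow> f' \<in> Arr (idx_cat C (St T))"
    "Dom ?I (inL f) = inL (Dom (idx_cat A (St S)) f)" "Dom ?I (inR f') = inR (Dom (idx_cat C (St T)) f')"
    "Cod ?I (inL f) = inL (Cod (idx_cat A (St S)) f)" "Cod ?I (inR f') = inR (Cod (idx_cat C (St T)) f')"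
    for i i' f f'
    by (simp_all add: St_oplus)
  note simps = inL idx_copair_cell component_copair_cell val_mixed
  show ?thesis
    unfolding is_cell_def copair_cell_simps
  proof (intro conjI ballI)
    have "component copair_cell i c z \<in> val R (idx_ob copair_cell i) (fob (star_fun BD G) c)"
      if "i \<in> Ob ?I" "c \<in> Ob (star_cat BD)" "z \<in> val ST i c" for i c z
      using that LC.desc_in RC.desc_in
      by (cases i rule: inL_inR_cases) (simp_all add: simps idx_unit)
    then show "component copair_cell \<in> (\<Pi>\<^sub>E i\<in>Ob ?I. \<Pi>\<^sub>E c\<in>Ob (star_cat BD).
        val ST i c \<rightarrow>\<^sub>E val R (idx_ob copair_cell i) (fob (star_fun BD G) c))"
      by (auto simp: copair_cell_def)
  next
    fix i u z assume *: "i \<in> Ob ?I" "u \<in> Arr (star_cat BD)" "z \<in> val ST i (Cod (star_cat BD) u)"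
    then show "component copair_cell i (Dom (star_cat BD) u) (act_out ST i u z) =
        act_out R (idx_ob copair_cell i) (far (star_fun BD G) u)
          (component copair_cell i (Cod (star_cat BD) u) z)"
      using out_in(1)[OF *] LC.desc_act_out RC.desc_act_out
      by (cases i rule: inL_inR_cases) (simp_all add: simps idx_unit)
  next
    fix f c z assume *: "f \<in> Arr ?I" "c \<in> Ob (star_cat BD)" "z \<in> val ST (Dom ?I f) c"
    show "component copair_cell (Cod ?I f) c (act_in ST f c z) =
        act_in R (idx_ar copair_cell f) (fob (star_fun BD G) c) (component copair_cell (Dom ?I f) c z)"
    proof (cases f rule: inL_inR_cases)
      \<comment> \<open>A mixed arrow has a mixed domain, over which there is no element
        \<open>z\<close>.\<close>
      case mixed
      then have "mixed (Dom ?I f)"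
        by (simp add: St_oplus mixed_idx_sum_cat)
      then show ?thesis
        using * by (simp add: val_mixed)
    qed (use * out_in(2)[OF *] LC.desc_act_in RC.desc_act_in in \<open>simp_all add: simps idx_unit\<close>)
  qed (unfold St_oplus, (rule cat_functor_copair_fun; rule cell_functors[OF \<sigma>] cell_functors[OF \<tau>])+)
qed

lemma fun_comp_unit:
  "fun_comp A (copair_fun A C (tight_src \<sigma>) (tight_src \<tau>)) (inl_fun A) = tight_src \<sigma>"
  "fun_comp C (copair_fun A C (tight_src \<sigma>) (tight_src \<tau>)) (inr_fun C) = tight_src \<tau>"
  "fun_comp B G (inl_fun B) = tight_tgt \<sigma>"
  "fun_comp D G (inr_fun D) = tight_tgt \<tau>"
  "fun_comp (St S) (copair_fun (St S) (St T) (state_fun \<sigma>) (state_fun \<tau>)) (inl_fun (St S)) = state_fun \<sigma>"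
  "fun_comp (St T) (copair_fun (St S) (St T) (state_fun \<sigma>) (state_fun \<tau>)) (inr_fun (St T)) = state_fun \<tau>"
  using cell_functors[OF \<sigma>] cell_functors[OF \<tau>] by (auto intro: fun_comp_copair_fun)

lemma vcomp_copair_cell: "vcomp A B S copair_cell LE.unit = \<sigma>" "vcomp C D T copair_cell RE.unit = \<tau>"
proof -
  have "component copair_cell (idx_ob LE.unit i) (fob LE.K b) (component LE.unit i b x)
      = component \<sigma> i b x" if *: "i \<in> Ob (idx_cat A (St S))" "b \<in> Ob (star_cat B)" "x \<in> val S i b" for i b x
    using LC.desc_unit[OF *] cell_component_in[OF LE.is_cell_unit *]
      component_copair_cell(1)[OF *(1) L.fob_in[OF *(2)]]
    by (simp add: idx_unit *(1))
  from restrict_cell_component[OF \<sigma> this] show "vcomp A B S copair_cell LE.unit = \<sigma>"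
    by (simp add: vcomp_def fun_comp_unit compose_def)
  have "component copair_cell (idx_ob RE.unit i) (fob RE.K b) (component RE.unit i b x)
      = component \<tau> i b x" if *: "i \<in> Ob (idx_cat C (St T))" "b \<in> Ob (star_cat D)" "x \<in> val T i b" for i b x
    using RC.desc_unit[OF *] cell_component_in[OF RE.is_cell_unit *]
      component_copair_cell(2)[OF *(1) R.fob_in[OF *(2)]]
    by (simp add: idx_unit *(1))
  from restrict_cell_component[OF \<tau> this] show "vcomp C D T copair_cell RE.unit = \<tau>"
    by (simp add: vcomp_def fun_comp_unit compose_def)
qed

lemma copair_cell_unique:
  assumes \<chi>: "is_cell AC BD ST X Y R \<chi>"
    and l: "vcomp A B S \<chi> LE.unit = \<sigma>" and r: "vcomp C D T \<chi> RE.unit = \<tau>"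
  shows "\<chi> = copair_cell"
proof (rule cell_eqI[OF \<chi> is_cell_copair_cell])
  have *: "tight_src \<sigma> = fun_comp A (tight_src \<chi>) (inl_fun A)" "tight_src \<tau> = fun_comp C (tight_src \<chi>) (inr_fun C)"
    "tight_tgt \<sigma> = fun_comp B (tight_tgt \<chi>) (inl_fun B)" "tight_tgt \<tau> = fun_comp D (tight_tgt \<chi>) (inr_fun D)"
    "state_fun \<sigma> = fun_comp (St S) (state_fun \<chi>) (inl_fun (St S))"
    "state_fun \<tau> = fun_comp (St T) (state_fun \<chi>) (inr_fun (St T))"
    unfolding l[symmetric] r[symmetric] by (simp_all add: vcomp_simps)
  show "tight_src \<chi> = tight_src copair_cell"
    using copair_fun_unique[OF cell_functors(1)[OF \<chi>] A.category_axioms C.category_axioms] by (simp add: *)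
  \<comment> \<open>Named because the comparison of components through
    \<open>component_eq_desc\<close> presupposes that \<open>\<chi>\<close> lies over
    \<open>G\<close>.\<close>
  show tgt: "tight_tgt \<chi> = tight_tgt copair_cell"
    using copair_fun_unique[OF cell_functors(2)[OF \<chi>] B.category_axioms D.category_axioms] by (simp add: *)
  show "state_fun \<chi> = state_fun copair_cell"
    using copair_fun_unique[OF cell_functors(3)[OF \<chi>, unfolded St_oplus] P.category_axioms Q.category_axioms]
    by (simp add: *)
  show "component \<chi> i c z = component copair_cell i c z"
    if "i \<in> Ob (idx_cat AC (St ST))" "c \<in> Ob (star_cat BD)" "z \<in> val ST i c" for i c z
    using that LC.component_eq_desc[OF \<chi> l tgt[simplified]] RC.component_eq_desc[OF \<chi> r tgt[simplified]]
    by (cases i rule: inL_inR_cases) (simp_all add: St_oplus idx_unit component_copair_cell val_mixed)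
qed

end

theorem mainTheorem8:
  fixes A :: "('ao, 'am) cat" and B :: "('bo, 'bm) cat"
    and C :: "('co, 'cm) cat" and D :: "('eo, 'em) cat"
    and S :: "('ao, 'am, 'po, 'pm, 'bo, 'bm, 'x) transducer"
    and T :: "('co, 'cm, 'qo, 'qm, 'eo, 'em, 'y) transducer"
  assumes S: "two_transducer A B S" and T: "two_transducer C D T"
  shows
    "two_transducer (sum_cat A C) (sum_cat B D) (oplus A B S C D T) \<and>
     is_cell A B S (sum_cat A C) (sum_cat B D) (oplus A B S C D T) (coproj_left A B S C D T) \<and>
     tight_src (coproj_left A B S C D T) = inl_fun A \<and>
     tight_tgt (coproj_left A B S C D T) = inl_fun B \<and>
     is_cell C D T (sum_cat A C) (sum_cat B D) (oplus A B S C D T) (coproj_right A B S C D T) \<and>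
     tight_src (coproj_right A B S C D T) = inr_fun C \<and>
     tight_tgt (coproj_right A B S C D T) = inr_fun D \<and>
     (\<forall>(X :: ('xo, 'xm) cat) (Y :: ('yo, 'ym) cat)
       (R :: ('xo, 'xm, 'ro, 'rm, 'yo, 'ym, 'z) transducer) \<sigma> \<tau>.
       two_transducer X Y R \<longrightarrow> is_cell A B S X Y R \<sigma> \<longrightarrow> is_cell C D T X Y R \<tau> \<longrightarrow>
       (\<exists>!\<chi>. is_cell (sum_cat A C) (sum_cat B D) (oplus A B S C D T) X Y R \<chi> \<and>
         vcomp A B S \<chi> (coproj_left A B S C D T) = \<sigma> \<and>
         vcomp C D T \<chi> (coproj_right A B S C D T) = \<tau>))"
proof -
  interpret transducer_pair A B C D S T
    using S T by (rule transducer_pair.intro)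
  have "\<exists>!\<chi>. is_cell AC BD ST X Y R \<chi> \<and> vcomp A B S \<chi> LE.unit = \<sigma> \<and> vcomp C D T \<chi> RE.unit = \<tau>"
    if "two_transducer X Y R" "is_cell A B S X Y R \<sigma>" "is_cell C D T X Y R \<tau>"
    for X :: "('xo, 'xm) cat" and Y :: "('yo, 'ym) cat"
      and R :: "('xo, 'xm, 'ro, 'rm, 'yo, 'ym, 'z) transducer" and \<sigma> \<tau>
  proof -
    interpret transducer_cocone A B C D S T X Y R \<sigma> \<tau>
      using that by (intro transducer_cocone.intro transducer_cocone_axioms.intro transducer_pair_axioms)
    show ?thesis
    proof (rule ex1I)
      show "is_cell AC BD ST X Y R copair_cell \<and> vcomp A B S copair_cell LE.unit = \<sigma> \<and>
          vcomp C D T copair_cell RE.unit = \<tau>"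
        by (intro conjI is_cell_copair_cell vcomp_copair_cell)
    qed (elim conjE, rule copair_cell_unique)
  qed
  then show ?thesis
    unfolding coproj_left_eq coproj_right_eq
    by (intro conjI allI impI two_transducer_oplus LE.is_cell_unit RE.is_cell_unit LE.unit_simps RE.unit_simps) simp_all
qed

end
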